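(* Let $H$ be a graph. Then $\mathrm{coind}(\mathrm{Hom}(K_2,H)) \geq 2$ if and only if there exist an odd integer $n\ge 3$ and a graph homomorphism $f: C_n \rightarrow H$ such that $\sigma_1(f) = 1$ in the group $\mathcal{G}_1(H)$.
   Context: Graphs are finite and undirected. For a graph $H$, $A(H)$ is its set of arcs: each edge $[u,v]$ gives the two arcs $(u,v)$ and $(v,u)$. Let $\mathcal{F}_1(A(H))$ be the free group on $A(H)$, and let $\mathcal{G}_1(H)$ be its quotient by the normal subgroup generated by all elements $(a,b)(c,b)^{-1}(c,d)(a,d)^{-1}$, where $a,b,c,d$ ranges over the 4-cycles of $H$ (vertices with $[a,b],[b,c],[c,d],[d,a]$ edges). $C_n$ is the cycle with vertex set $\mathbb{Z}_n=\{0,\dots,n-1\}$ and edges $[i,i+1]$. For odd $n$ and a homomorphism $f:C_n\to H$, its signature is $\sigma_1(f)=\prod_{i=0}^{n-1}(f(2i),f(2i+1))\cdot(f(2i+2),f(2i+1))^{-1}\in\mathcal{G}_1(H)$, indices taken modulo $n$, product developed left to right ($x_0x_1\cdots x_{n-1}$). The hom-complex $\mathrm{Hom}(K_2,H)$ is the poset of pairs $(A,B)$ of nonempty subsets of $V(H)$ such that every vertex of $A$ is adjacent to every vertex of $B$, ordered by coordinatewise inclusion, with the fixed-point-free order-preserving involution $-(A,B)=(B,A)$. It is viewed as a $\mathbb{Z}_2$-space via the geometric realization of its order complex (simplices = chains), with the induced involution. For a $\mathbb{Z}_2$-space $X$ (space with a fixed-point-free involution), $\mathrm{coind}(X)$ is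 the largest $k$ such that there is a continuous map $S^k\to X$ commuting with the involutions, where $S^k\subseteq\mathbb{R}^{k+1}$ is the unit sphere with the antipodal map. *)

theory Defs
  imports
    "HOL-Analysis.Analysis"
    "HOL-Algebra.Coset"
    "Graph_Theory.Pair_Digraph"
begin

section \<open>Free groups\<close>

text \<open>A letter is a generator \<open>(False, x)\<close> or a formal inverse \<open>(True, x)\<close>. The elements of the
  free group on \<open>S\<close> are the reduced words; \<open>free_push\<close> multiplies a reduced word by a letter
  on the left.\<close>

type_synonym 'x word = "(bool \<times> 'x) list"

definition inv_letter :: "bool \<times> 'x \<Rightarrow> bool \<times> 'x" where
  "inv_letter a = (\<not> fst a, snd a)"

definition reduced_word :: "'x word \<Rightarrow> bool" where
  "reduced_word w \<longleftrightarrow> successively (\<lambda>a b. b \<noteq> inv_letter a) w"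

fun free_push :: "bool \<times> 'x \<Rightarrow> 'x word \<Rightarrow> 'x word" where
  "free_push a [] = [a]"
| "free_push a (b # w) = (if b = inv_letter a then w else a # b # w)"

definition free_mult :: "'x word \<Rightarrow> 'x word \<Rightarrow> 'x word" where
  "free_mult u v = foldr free_push u v"

definition free_group :: "'x set \<Rightarrow> 'x word monoid" where
  "free_group S =
    \<lparr>carrier = {w. set w \<subseteq> UNIV \<times> S \<and> reduced_word w}, monoid.mult = free_mult, one = []\<rparr>"

definition free_gen :: "'x \<Rightarrow> 'x word" where
  "free_gen x = [(False, x)]"

lemma inv_letter_inv_letter [simp]: "inv_letter (inv_letter a) = a"
  by (simp add: inv_letter_def)

lemma inv_letter_neq [simp]: "inv_letter a \<noteq> a" "a \<noteq> inv_letter a"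
  by (auto simp: inv_letter_def prod_eq_iff)

lemma reduced_word_Cons:
  "reduced_word (a # w) \<longleftrightarrow> reduced_word w \<and> (w = [] \<or> hd w \<noteq> inv_letter a)"
  by (cases w) (auto simp: reduced_word_def)

lemma reduced_word_Nil [simp]: "reduced_word []"
  by (simp add: reduced_word_def)

lemma reduced_word_free_push: "reduced_word w \<Longrightarrow> reduced_word (free_push a w)"
  by (cases w) (auto simp: reduced_word_Cons)

lemma free_push_inv: "reduced_word w \<Longrightarrow> free_push a (free_push (inv_letter a) w) = w"
  by (cases w; cases "tl w") (auto simp: reduced_word_Cons)

lemma free_push_Cons: "reduced_word (a # w) \<Longrightarrow> free_push a w = a # w"
  by (cases w) (auto simp: reduced_word_Cons)

lemma reduced_word_free_mult: "reduced_word v \<Longrightarrow> reduced_word (free_mult u v)"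
  unfolding free_mult_def by (induction u) (auto intro: reduced_word_free_push)

lemma set_free_push: "set (free_push a w) \<subseteq> insert a (set w)"
  by (cases w) auto

lemma set_free_mult: "set (free_mult u v) \<subseteq> set u \<union> set v"
  unfolding free_mult_def
proof (induction u)
  case (Cons a u)
  then show ?case using set_free_push[of a "foldr free_push u v"] by auto
qed simp

lemma free_mult_free_push:
  assumes "reduced_word w"
  shows "free_mult (free_push a u) w = free_push a (free_mult u w)"
proof (cases u)
  case Nil
  then show ?thesis by (simp add: free_mult_def)
next
  case (Cons b v)
  then show ?thesis
    using free_push_inv[OF reduced_word_free_mult[OF assms, of v], of a]
    by (auto simp: free_mult_def)
qed

lemma free_mult_assoc:
  assumes "reduced_word w"
  shows "free_mult (free_mult u v) w = free_mult u (free_mult v w)"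
proof (induction u)
  case Nil
  show ?case by (simp add: free_mult_def)
next
  case (Cons a u)
  have "free_mult (free_mult (a # u) v) w = free_mult (free_push a (free_mult u v)) w"
    by (simp add: free_mult_def)
  also have "\<dots> = free_push a (free_mult (free_mult u v) w)"
    using assms by (rule free_mult_free_push)
  also have "\<dots> = free_mult (a # u) (free_mult v w)"
    unfolding Cons by (simp add: free_mult_def)
  finally show ?case .
qed

lemma free_mult_Nil_left: "free_mult [] u = u"
  by (simp add: free_mult_def)

lemma free_mult_Nil_right: "reduced_word u \<Longrightarrow> free_mult u [] = u"
proof (induction u)
  case (Cons a u)
  then show ?case
    using free_push_Cons[of a u] by (auto simp: free_mult_def reduced_word_Cons)
qed (simp add: free_mult_def)

lemma free_mult_rev_inv: "free_mult (map inv_letter (rev u)) u = []"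
  by (induction u) (auto simp: free_mult_def)

lemma group_free_group: "group (free_group S)"
proof (rule groupI)
  fix u assume u: "u \<in> carrier (free_group S)"
  let ?u' = "free_mult (map inv_letter (rev u)) []"
  have "?u' \<in> carrier (free_group S)"
    using u set_free_mult[of "map inv_letter (rev u)" "[]"]
    by (fastforce simp: free_group_def inv_letter_def reduced_word_free_mult)
  moreover have "?u' \<otimes>\<^bsub>free_group S\<^esub> u = \<one>\<^bsub>free_group S\<^esub>"
    using u free_mult_rev_inv[of u]
    by (simp add: free_group_def free_mult_assoc) (simp add: free_mult_def)
  ultimately show "\<exists>v\<in>carrier (free_group S). v \<otimes>\<^bsub>free_group S\<^esub> u = \<one>\<^bsub>free_group S\<^esub>"
    by blast
next
  fix u v assume "u \<in> carrier (free_group S)" "v \<in> carrier (free_group S)"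
  then show "u \<otimes>\<^bsub>free_group S\<^esub> v \<in> carrier (free_group S)"
    using set_free_mult[of u v] by (auto simp: free_group_def reduced_word_free_mult)
qed (auto simp: free_group_def free_mult_assoc free_mult_Nil_left)

lemma free_gen_in_carrier: "x \<in> S \<Longrightarrow> free_gen x \<in> carrier (free_group S)"
  by (simp add: free_gen_def free_group_def reduced_word_Cons)

section \<open>The group and the signature\<close>

definition normal_closure :: "('g, 'm) monoid_scheme \<Rightarrow> 'g set \<Rightarrow> 'g set" where
  "normal_closure G R = \<Inter>{N. N \<lhd> G \<and> R \<subseteq> N}"

lemma normal_normal_closure:
  assumes "group G" "R \<subseteq> carrier G"
  shows "normal_closure G R \<lhd> G"
proof -
  interpret group G by fact
  let ?\<N> = "{N. N \<lhd> G \<and> R \<subseteq> N}"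
  have "carrier G \<lhd> G"
    by (simp add: normal_inv_iff subgroup_self)
  then have ne: "?\<N> \<noteq> {}" using assms by blast
  have "subgroup (\<Inter>?\<N>) G"
    by (rule subgroups_Inter) (use ne in \<open>auto intro: normal_imp_subgroup\<close>)
  then show ?thesis
    unfolding normal_closure_def normal_inv_iff by blast
qed

text \<open>Degenerate 4-cycles, with \<open>a = c\<close> or \<open>b = d\<close>, contribute only the trivial word.\<close>

definition four_cycle_relators :: "'a pair_pre_digraph \<Rightarrow> ('a \<times> 'a) word set" where
  "four_cycle_relators H =
    {free_gen (a, b) \<otimes>\<^bsub>F\<^esub> inv\<^bsub>F\<^esub> (free_gen (c, b)) \<otimes>\<^bsub>F\<^esub> free_gen (c, d) \<otimes>\<^bsub>F\<^esub> inv\<^bsub>F\<^esub> (free_gen (a, d))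
      | F a b c d. F = free_group (parcs H) \<and>
          (a, b) \<in> parcs H \<and> (b, c) \<in> parcs H \<and> (c, d) \<in> parcs H \<and> (d, a) \<in> parcs H}"

definition arc_normal :: "'a pair_pre_digraph \<Rightarrow> ('a \<times> 'a) word set" where
  "arc_normal H = normal_closure (free_group (parcs H)) (four_cycle_relators H)"

definition arc_group :: "'a pair_pre_digraph \<Rightarrow> ('a \<times> 'a) word set monoid" where
  "arc_group H = free_group (parcs H) Mod arc_normal H"

definition arc_class :: "'a pair_pre_digraph \<Rightarrow> 'a \<times> 'a \<Rightarrow> ('a \<times> 'a) word set" where
  "arc_class H e = arc_normal H #>\<^bsub>free_group (parcs H)\<^esub> free_gen e"

definition cycle_graph :: "nat \<Rightarrow> nat pair_pre_digraph" where
  "cycle_graph n =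
    \<lparr>pverts = {0..<n},
     parcs = {(i, j). i < n \<and> j < n \<and> (j = (i + 1) mod n \<or> i = (j + 1) mod n)}\<rparr>"

definition graph_hom ::
    "('a \<Rightarrow> 'b) \<Rightarrow> 'a pair_pre_digraph \<Rightarrow> 'b pair_pre_digraph \<Rightarrow> bool" where
  "graph_hom f G H \<longleftrightarrow>
    (\<forall>v\<in>pverts G. f v \<in> pverts H) \<and> (\<forall>(u, v)\<in>parcs G. (f u, f v) \<in> parcs H)"

definition signature :: "'a pair_pre_digraph \<Rightarrow> nat \<Rightarrow> (nat \<Rightarrow> 'a) \<Rightarrow> ('a \<times> 'a) word set" where
  "signature H n f =
    foldr (\<lambda>x y. x \<otimes>\<^bsub>arc_group H\<^esub> y)
      (map (\<lambda>i. arc_class H (f (2 * i mod n), f ((2 * i + 1) mod n)) \<otimes>\<^bsub>arc_group H\<^esub>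
                inv\<^bsub>arc_group H\<^esub> arc_class H (f ((2 * i + 2) mod n), f ((2 * i + 1) mod n)))
        [0..<n])
      \<one>\<^bsub>arc_group H\<^esub>"

lemma four_cycle_relators_subset:
  assumes "pair_graph H"
  shows "four_cycle_relators H \<subseteq> carrier (free_group (parcs H))"
proof -
  interpret pair_graph H by fact
  interpret F: group "free_group (parcs H)" by (rule group_free_group)
  show ?thesis
    unfolding four_cycle_relators_def
    using arcs_symmetric by (auto intro!: F.m_closed F.inv_closed free_gen_in_carrier)
qed

lemma normal_arc_normal: "pair_graph H \<Longrightarrow> arc_normal H \<lhd> free_group (parcs H)"
  unfolding arc_normal_def
  by (intro normal_normal_closure group_free_group four_cycle_relators_subset)

lemma group_arc_group: "pair_graph H \<Longrightarrow> group (arc_group H)"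
  unfolding arc_group_def by (intro normal.factorgroup_is_group normal_arc_normal)

section \<open>The hom-complex and its coindex\<close>

definition hom_K2 :: "'a pair_pre_digraph \<Rightarrow> ('a set \<times> 'a set) set" where
  "hom_K2 H = {(A, B). A \<noteq> {} \<and> B \<noteq> {} \<and> A \<subseteq> pverts H \<and> B \<subseteq> pverts H \<and> A \<times> B \<subseteq> parcs H}"

definition order_complex :: "'p::order set \<Rightarrow> 'p set set" where
  "order_complex P = {\<sigma>. \<sigma> \<noteq> {} \<and> finite \<sigma> \<and> \<sigma> \<subseteq> P \<and> Complete_Partial_Order.chain (\<le>) \<sigma>}"

text \<open>Points are given by barycentric coordinates. The product topology agrees with the
  weak topology only for finite complexes.\<close>

definition geometric_realization :: "'p set set \<Rightarrow> ('p \<Rightarrow> real) topology" where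
  "geometric_realization K =
    subtopology (powertop_real UNIV)
      {t. (\<forall>p. 0 \<le> t p) \<and> {p. t p \<noteq> 0} \<in> K \<and> (\<Sum>p | t p \<noteq> 0. t p) = 1}"

text \<open>The order on pairs of sets is the coordinatewise inclusion of \<^theory>\<open>HOL-Library.Product_Order\<close>.\<close>

definition hom_K2_space :: "'a pair_pre_digraph \<Rightarrow> ('a set \<times> 'a set \<Rightarrow> real) topology" where
  "hom_K2_space H = geometric_realization (order_complex (hom_K2 H))"

text \<open>The linear extension of \<open>prod.swap\<close>: the coordinate of the image at \<open>(A, B)\<close> is the
  coordinate of the original point at \<open>(B, A)\<close>.\<close>

definition hom_K2_involution :: "('a set \<times> 'a set \<Rightarrow> real) \<Rightarrow> 'a set \<times> 'a set \<Rightarrow> real" where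
  "hom_K2_involution t = t \<circ> prod.swap"

text \<open>With values in the extended reals, the coindex is \<open>-\<infinity>\<close> for the empty space and \<open>\<infinity>\<close> if
  there are equivariant maps from spheres of all dimensions; otherwise the supremum is a maximum.\<close>

definition coind :: "'x topology \<Rightarrow> ('x \<Rightarrow> 'x) \<Rightarrow> ereal" where
  "coind X \<nu> =
    (SUP k \<in> {k. \<exists>g. continuous_map (nsphere k) X g \<and>
                     (\<forall>x\<in>topspace (nsphere k). g (\<lambda>i. - x i) = \<nu> (g x))}. ereal (real k))"

definition Z2_space :: "'x topology \<Rightarrow> ('x \<Rightarrow> 'x) \<Rightarrow> bool" where
  "Z2_space X \<nu> \<longleftrightarrow> continuous_map X X \<nu> \<and> (\<forall>x\<in>topspace X. \<nu> (\<nu> x) = x \<and> \<nu> x \<noteq> x)"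

lemma swap_in_order_complex_hom_K2:
  assumes "pair_graph H" "\<sigma> \<in> order_complex (hom_K2 H)"
  shows "prod.swap ` \<sigma> \<in> order_complex (hom_K2 H)"
proof -
  interpret pair_graph H by fact
  have "prod.swap ` \<sigma> \<subseteq> hom_K2 H"
    using assms(2) arcs_symmetric by (fastforce simp: order_complex_def hom_K2_def)
  moreover have "Complete_Partial_Order.chain (\<le>) (prod.swap ` \<sigma>)"
    using assms(2)
    by (simp add: order_complex_def Complete_Partial_Order.chain_def less_eq_prod_def) blast
  ultimately show ?thesis
    using assms(2) by (auto simp: order_complex_def)
qed

lemma Z2_space_hom_K2:
  assumes "pair_graph H"
  shows "Z2_space (hom_K2_space H) hom_K2_involution"
proof -
  interpret pair_graph H by fact
  let ?X = "{t. (\<forall>p. 0 \<le> t p) \<and> {p. t p \<noteq> 0} \<in> order_complex (hom_K2 H) \<and>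
    (\<Sum>p | t p \<noteq> 0. t p) = (1::real)}"
  have supp: "{p. hom_K2_involution t p \<noteq> 0} = prod.swap ` {p. t p \<noteq> 0}"
    for t :: "'a set \<times> 'a set \<Rightarrow> real"
    by (force simp: hom_K2_involution_def)
  have inX: "hom_K2_involution t \<in> ?X" if "t \<in> ?X" for t
  proof -
    have "(\<Sum>p\<in>prod.swap ` {p. t p \<noteq> 0}. hom_K2_involution t p) = (\<Sum>p | t p \<noteq> 0. t p)"
      by (subst sum.reindex) (auto simp: hom_K2_involution_def)
    then have "(\<Sum>p | hom_K2_involution t p \<noteq> 0. hom_K2_involution t p) = 1"
      unfolding supp using that by simp
    moreover have "{p. hom_K2_involution t p \<noteq> 0} \<in> order_complex (hom_K2 H)"
      unfolding supp using that by (intro swap_in_order_complex_hom_K2 assms) simp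
    ultimately show ?thesis
      using that by (simp add: hom_K2_involution_def)
  qed
  have "continuous_map (powertop_real UNIV) (powertop_real UNIV)
      (hom_K2_involution :: ('a set \<times> 'a set \<Rightarrow> real) \<Rightarrow> _)"
    by (auto simp: continuous_map_componentwise_UNIV hom_K2_involution_def
        intro: continuous_map_product_projection)
  then have cont: "continuous_map (hom_K2_space H) (hom_K2_space H) hom_K2_involution"
    unfolding hom_K2_space_def geometric_realization_def
    using inX by (auto simp: continuous_map_in_subtopology intro: continuous_map_from_subtopology)
  have free: "hom_K2_involution t \<noteq> t" if t: "t \<in> ?X" for t
  proof
    assume eq: "hom_K2_involution t = t"
    obtain A B where AB: "t (A, B) \<noteq> 0"
      using t by (auto simp: order_complex_def)
    have BA: "t (B, A) \<noteq> 0"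
      using AB fun_cong[OF eq, of "(A, B)"] by (simp add: hom_K2_involution_def)
    have "Complete_Partial_Order.chain (\<le>) {p. t p \<noteq> 0}" and sub: "{p. t p \<noteq> 0} \<subseteq> hom_K2 H"
      using t by (auto simp: order_complex_def)
    then have "(A, B) \<le> (B, A) \<or> (B, A) \<le> (A, B)"
      using AB BA by (simp add: Complete_Partial_Order.chain_def)
    then have "A = B" by auto
    moreover have "(A, B) \<in> hom_K2 H" using sub AB by auto
    ultimately obtain a where "(a, a) \<in> parcs H"
      by (auto simp: hom_K2_def)
    then show False
      using pair_no_loops by fastforce
  qed
  have "topspace (hom_K2_space H) = ?X"
    by (simp add: hom_K2_space_def geometric_realization_def)
  then show ?thesis
    using cont free by (auto simp: Z2_space_def) (auto simp: hom_K2_involution_def)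
qed

end

theory Submission
  imports Defs
begin

text \<open>
  In the arc group the element \<open>(a, y) (c, y)\<^sup>-\<^sup>1\<close> does not depend on the common neighbour \<open>y\<close> of
  \<open>a\<close> and \<open>c\<close>, so it is a multiplicative cocycle for the relation of having a common neighbour, and
  the signature of \<open>f\<close> is its product along \<open>f(0), f(2), f(4), \<dots>\<close>, where \<open>f\<close> is traversed twice.

  Given an equivariant map of the sphere, label the points of a fine grid of spherical coordinates
  equivariantly by elements of the poset such that the labels of each cell form a chain. The
  cocycle of representatives is trivial around each cell, hence around the equator, and the labels
  along half of the equator form an odd closed walk.

  Conversely, let \<open>e\<^sub>i\<close> be the \<open>i\<close>-th arc of an odd cycle \<open>f\<close> of length \<open>n\<close>, oriented from its even to
  its odd position in the doubled walk. Then \<open>e\<^sub>i\<^sub>+\<^sub>n\<close> is the reverse of \<open>e\<^sub>i\<close>, so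
  \<open>e\<^sub>0, \<dots>, e\<^sub>2\<^sub>n\<close> is an antipodally symmetric loop in the hom-complex. Mapping the generators of the
  free group to loops based at \<open>e\<^sub>0\<close> kills the relators, so a trivial signature makes this loop
  null-homotopic. Equivalently, a path \<open>\<gamma>\<close> from \<open>e\<^sub>0\<close> to its antipode is homotopic to the reverse of
  its antipodal path. Such a homotopy is a map of a square, that is, of a hemisphere, with
  antipodal boundary values, and extends to the sphere.
\<close>

section \<open>Homotopies of paths in topological spaces\<close>

text \<open>The corresponding library facts are stated with \<open>linepath\<close> and hence only for normed spaces.\<close>

lemma homotopic_paths_rid_const:
  fixes p :: "real \<Rightarrow> 'x::topological_space"
  assumes "path p" "path_image p \<subseteq> S" "pathfinish p = x"
  shows "homotopic_paths S (p +++ (\<lambda>_. x)) p"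
proof -
  have "continuous_on {0..1::real} (\<lambda>t. min (2 * t) 1)" by (intro continuous_intros)
  then have "homotopic_paths S p (p +++ (\<lambda>_. x))"
    by (rule homotopic_paths_reparametrize[OF assms(1,2)])
      (use assms(3) in \<open>auto simp: joinpaths_def pathfinish_def min_def\<close>)
  then show ?thesis by (rule homotopic_paths_sym)
qed

lemma homotopic_paths_lid_const:
  fixes p :: "real \<Rightarrow> 'x::topological_space"
  assumes "path p" "path_image p \<subseteq> S" "pathstart p = x"
  shows "homotopic_paths S ((\<lambda>_. x) +++ p) p"
proof -
  have "continuous_on {0..1::real} (\<lambda>t. max (2 * t - 1) 0)" by (intro continuous_intros)
  then have "homotopic_paths S p ((\<lambda>_. x) +++ p)"
    by (rule homotopic_paths_reparametrize[OF assms(1,2)])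
      (use assms(3) in \<open>auto simp: joinpaths_def pathstart_def max_def\<close>)
  then show ?thesis by (rule homotopic_paths_sym)
qed

lemma path_const_topological: "path (\<lambda>_. x :: 'x::topological_space)"
  by (simp add: path_def)

text \<open>The contraction moves the endpoints, so a deformed path is joined to the fixed endpoints
  by their tracks: \<open>r p s\<close> follows the track of the start up to time \<open>s\<close>,
  the path deformed to time \<open>s\<close>, and the track of the finish back. \<open>r p 0\<close>
  is \<open>p\<close> padded by constants, and \<open>r p 1\<close> depends only on the endpoints of
  \<open>p\<close>.\<close>

lemma homotopic_paths_contraction:
  fixes c :: "real \<times> 'x \<Rightarrow> 'x::topological_space"
  assumes cont: "continuous_on ({0..1} \<times> S) c" and cS: "c ` ({0..1} \<times> S) \<subseteq> S"
    and c0: "\<And>x. x \<in> S \<Longrightarrow> c (0, x) = x" and c1: "\<And>x. x \<in> S \<Longrightarrow> c (1, x) = a"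
    and p: "path p" "path_image p \<subseteq> S" and q: "path q" "path_image q \<subseteq> S"
    and ends: "pathstart p = pathstart q" "pathfinish p = pathfinish q"
  shows "homotopic_paths S p q"
proof -
  have cS': "c (s, x) \<in> S" if "s \<in> {0..1}" "x \<in> S" for s x
    using cS that by auto
  define r where "r p s = (\<lambda>u. c (s * u, pathstart p)) +++ ((\<lambda>u. c (s, p u)) +++ (\<lambda>u. c (s * (1 - u), pathfinish p)))"
    for p :: "real \<Rightarrow> 'x" and s :: real
  have key: "homotopic_paths S p (r p 1)" if "path p" "path_image p \<subseteq> S" for p
  proof -
    have pS: "p u \<in> S" if "u \<in> {0..1}" for u
      using \<open>path_image p \<subseteq> S\<close> that by (auto simp: path_image_def)
    then have endS: "pathstart p \<in> S" "pathfinish p \<in> S"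
      by (auto simp: pathstart_def pathfinish_def)
    let ?A = "{0..1::real} \<times> {0..1::real}"
    have pc: "continuous_on {0..1} p" using that(1) by (simp add: path_def)
    have k1: "continuous_on ?A (\<lambda>y. c (fst y * snd y, pathstart p))"
      using endS by (intro continuous_on_compose2[OF cont] continuous_intros) (auto simp: mult_le_one)
    have k2: "continuous_on ?A (\<lambda>y. c (fst y, p (snd y)))"
      using pS by (intro continuous_on_compose2[OF cont] continuous_on_compose2[OF pc] continuous_intros) auto
    have k3: "continuous_on ?A (\<lambda>y. c (fst y * (1 - snd y), pathfinish p))"
      using endS by (intro continuous_on_compose2[OF cont] continuous_intros) (auto simp: mult_le_one)
    have k: "continuous_on ?A (\<lambda>y. r p (fst y) (snd y))"
      unfolding r_def
      by (intro continuous_on_homotopic_join_lemma k1 k2 k3) (auto simp: pathstart_def pathfinish_def joinpaths_def)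
    have rS: "r p s u \<in> S" if "s \<in> {0..1}" "u \<in> {0..1}" for s u
      unfolding r_def joinpaths_def using that pS endS
      by (auto intro!: cS' pS simp: mult_le_one)
    have "homotopic_paths S (r p 0) (r p 1)"
      unfolding homotopic_paths
    proof (intro exI[of _ "\<lambda>y. r p (fst y) (snd y)"] conjI ballI)
      show "(\<lambda>y. r p (fst y) (snd y)) \<in> ?A \<rightarrow> S" using rS by auto
    qed (use k in \<open>simp_all add: r_def joinpaths_def pathstart_def pathfinish_def\<close>)
    moreover have "homotopic_paths S (r p 0) p"
    proof -
      have "homotopic_paths S (r p 0) ((\<lambda>_. pathstart p) +++ (p +++ (\<lambda>_. pathfinish p)))"
        using \<open>homotopic_paths S (r p 0) (r p 1)\<close>
        by (intro homotopic_paths_eq)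
          (auto dest: homotopic_paths_imp_path homotopic_paths_imp_subset
            simp: r_def joinpaths_def c0 endS pS)
      also have "homotopic_paths S \<dots> (p +++ (\<lambda>_. pathfinish p))"
      proof (rule homotopic_paths_lid_const)
        show "path (p +++ (\<lambda>_. pathfinish p))"
          using that path_const_topological by (intro path_join_imp) (auto simp: pathstart_def)
        show "path_image (p +++ (\<lambda>_. pathfinish p)) \<subseteq> S"
          using that endS by (intro subset_path_image_join) auto
      qed simp
      also have "homotopic_paths S \<dots> p"
        using that by (rule homotopic_paths_rid_const) simp
      finally show ?thesis .
    qed
    ultimately show ?thesis
      by (meson homotopic_paths_sym homotopic_paths_trans)
  qed
  have "homotopic_paths S (r p 1) (r q 1)"
  proof (rule homotopic_paths_eq)
    show "path (r p 1)" "path_image (r p 1) \<subseteq> S"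
      using key[OF p] by (auto dest: homotopic_paths_imp_path homotopic_paths_imp_subset)
    fix t :: real assume "t \<in> {0..1}"
    \<comment> \<open>\<open>2 * (2 * t - 1)\<close> is the parameter of the middle piece, the only
      one in which \<open>p\<close> and \<open>q\<close> could differ; there \<open>c (1, _)\<close>
      is constantly \<open>a\<close>.\<close>
    then have "p (2 * (2 * t - 1)) \<in> S \<and> q (2 * (2 * t - 1)) \<in> S" if "\<not> t \<le> 1/2" "2 * t - 1 \<le> 1/2"
      using p(2) q(2) that by (auto simp: path_image_def)
    then show "r p 1 t = r q 1 t"
      using ends by (auto simp: r_def joinpaths_def c1)
  qed
  then show ?thesis
    using key[OF p] key[OF q] by (meson homotopic_paths_sym homotopic_paths_trans)
qed

section \<open>The arc group\<close>

context group begin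

definition lprod :: "'a list \<Rightarrow> 'a" where
  "lprod xs = foldr (\<otimes>) xs \<one>"

lemma lprod_Nil [simp]: "lprod [] = \<one>"
  by (simp add: lprod_def)

lemma lprod_Cons [simp]: "lprod (x # xs) = x \<otimes> lprod xs"
  by (simp add: lprod_def)

lemma lprod_closed [simp]: "set xs \<subseteq> carrier G \<Longrightarrow> lprod xs \<in> carrier G"
  by (induction xs) auto

lemma lprod_append:
  "set xs \<subseteq> carrier G \<Longrightarrow> set ys \<subseteq> carrier G \<Longrightarrow> lprod (xs @ ys) = lprod xs \<otimes> lprod ys"
  by (induction xs) (auto simp: m_assoc)

lemma inv_lprod:
  "set xs \<subseteq> carrier G \<Longrightarrow> inv (lprod xs) = lprod (rev (map (\<lambda>x. inv x) xs))"
proof (induction xs)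
  case (Cons x xs)
  then have "set (rev (map (\<lambda>x. inv x) xs)) \<subseteq> carrier G" by auto
  then show ?case using Cons by (simp add: lprod_append inv_mult_group)
qed simp

end

locale arc_graph =
  fixes H :: "'a pair_pre_digraph"
  assumes pair_graph_H: "pair_graph H"
begin

sublocale pair_graph H by (rule pair_graph_H)

abbreviation F where "F \<equiv> free_group (parcs H)"
abbreviation G where "G \<equiv> arc_group H"
abbreviation cls where "cls \<equiv> arc_class H"

sublocale F: group F by (rule group_free_group)
sublocale G: group G by (rule group_arc_group[OF pair_graph_H])
sublocale N: normal "arc_normal H" F by (rule normal_arc_normal[OF pair_graph_H])

lemma arc_sym: "(u, v) \<in> parcs H \<Longrightarrow> (v, u) \<in> parcs H"
  using arcs_symmetric by auto

lemma arc_verts: "(u, v) \<in> parcs H \<Longrightarrow> u \<in> pverts H \<and> v \<in> pverts H"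
  by (auto dest: in_arcsD1 in_arcsD2)

definition proj where "proj w = arc_normal H #>\<^bsub>F\<^esub> w"

lemma proj_hom: "group_hom F G proj"
  unfolding proj_def arc_group_def
  by (intro group_hom.intro group_hom_axioms.intro N.r_coset_hom_Mod N.factorgroup_is_group group_free_group)

sublocale proj: group_hom F G proj by (rule proj_hom)

lemma cls_eq_proj: "cls e = proj (free_gen e)"
  by (simp add: arc_class_def proj_def)

lemma cls_closed: "e \<in> parcs H \<Longrightarrow> cls e \<in> carrier G"
  by (simp add: cls_eq_proj free_gen_in_carrier)

lemma proj_eq_one_iff: "w \<in> carrier F \<Longrightarrow> proj w = \<one>\<^bsub>G\<^esub> \<longleftrightarrow> w \<in> arc_normal H"
  unfolding proj_def arc_group_def FactGroup_def
  by (metis F.coset_join1 F.coset_join2 N.is_subgroup monoid.select_convs(2))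

lemma four_cycle_relators_subset_arc_normal: "four_cycle_relators H \<subseteq> arc_normal H"
  by (auto simp: arc_normal_def normal_closure_def)

text \<open>The relator of the 4-cycle vanishes in the quotient; moving its second half to the other
  side shows that \<open>b\<close> may be exchanged for \<open>d\<close>.\<close>

lemma cls_four_cycle:
  assumes "(a, b) \<in> parcs H" "(c, b) \<in> parcs H" "(c, d) \<in> parcs H" "(a, d) \<in> parcs H"
  shows "cls (a, b) \<otimes>\<^bsub>G\<^esub> inv\<^bsub>G\<^esub> cls (c, b) = cls (a, d) \<otimes>\<^bsub>G\<^esub> inv\<^bsub>G\<^esub> cls (c, d)"
proof -
  let ?r = "free_gen (a, b) \<otimes>\<^bsub>F\<^esub> inv\<^bsub>F\<^esub> (free_gen (c, b)) \<otimes>\<^bsub>F\<^esub> free_gen (c, d) \<otimes>\<^bsub>F\<^esub> inv\<^bsub>F\<^esub> (free_gen (a, d))"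
  have gens: "free_gen (a, b) \<in> carrier F" "free_gen (c, b) \<in> carrier F"
    "free_gen (c, d) \<in> carrier F" "free_gen (a, d) \<in> carrier F"
    using assms by (auto intro: free_gen_in_carrier)
  have "?r \<in> four_cycle_relators H"
    unfolding four_cycle_relators_def using assms arc_sym by blast
  then have "proj ?r = \<one>\<^bsub>G\<^esub>"
    using four_cycle_relators_subset_arc_normal gens by (subst proj_eq_one_iff) auto
  then have "cls (a, b) \<otimes>\<^bsub>G\<^esub> inv\<^bsub>G\<^esub> cls (c, b) \<otimes>\<^bsub>G\<^esub> (cls (c, d) \<otimes>\<^bsub>G\<^esub> inv\<^bsub>G\<^esub> cls (a, d)) = \<one>\<^bsub>G\<^esub>"
    using gens by (simp add: cls_eq_proj proj.hom_mult G.m_assoc)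
  then have "cls (a, b) \<otimes>\<^bsub>G\<^esub> inv\<^bsub>G\<^esub> cls (c, b) = inv\<^bsub>G\<^esub> (cls (c, d) \<otimes>\<^bsub>G\<^esub> inv\<^bsub>G\<^esub> cls (a, d))"
    using assms by (intro G.inv_equality[symmetric]) (auto intro: cls_closed)
  also have "\<dots> = cls (a, d) \<otimes>\<^bsub>G\<^esub> inv\<^bsub>G\<^esub> cls (c, d)"
    using assms by (simp add: G.inv_mult_group cls_closed)
  finally show ?thesis .
qed

subsection \<open>The cocycle on pairs of vertices with a common neighbour\<close>

text \<open>The nonempty sets with this property are the simplices of the neighbourhood complex of
  \<open>H\<close>.\<close>

definition common_nb :: "'a set \<Rightarrow> bool" where
  "common_nb S \<longleftrightarrow> (\<exists>y. \<forall>x\<in>S. (x, y) \<in> parcs H)"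

text \<open>The choice of \<open>y\<close> is immaterial by \<open>lam_eq\<close>. The value is
  meaningful only if \<open>a\<close> and \<open>c\<close> have a common neighbour.\<close>

definition lam :: "'a \<Rightarrow> 'a \<Rightarrow> ('a \<times> 'a) word set" where
  "lam a c = (let y = (SOME y. (a, y) \<in> parcs H \<and> (c, y) \<in> parcs H)
    in cls (a, y) \<otimes>\<^bsub>G\<^esub> inv\<^bsub>G\<^esub> cls (c, y))"

lemma lam_eq:
  assumes "(a, y) \<in> parcs H" "(c, y) \<in> parcs H"
  shows "lam a c = cls (a, y) \<otimes>\<^bsub>G\<^esub> inv\<^bsub>G\<^esub> cls (c, y)"
proof -
  define z where "z = (SOME y. (a, y) \<in> parcs H \<and> (c, y) \<in> parcs H)"
  have "(a, z) \<in> parcs H \<and> (c, z) \<in> parcs H"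
    unfolding z_def by (rule someI_ex) (use assms in blast)
  moreover have "lam a c = cls (a, z) \<otimes>\<^bsub>G\<^esub> inv\<^bsub>G\<^esub> cls (c, z)"
    unfolding lam_def z_def[symmetric] by (simp add: Let_def)
  ultimately show ?thesis
    using assms cls_four_cycle[of a z c y] by simp
qed

lemma common_nb_mono: "common_nb T \<Longrightarrow> S \<subseteq> T \<Longrightarrow> common_nb S"
  by (auto simp: common_nb_def)

lemma lam_closed: "common_nb {a, c} \<Longrightarrow> lam a c \<in> carrier G"
  by (auto simp: common_nb_def lam_eq cls_closed)

lemma lam_refl: "common_nb {a} \<Longrightarrow> lam a a = \<one>\<^bsub>G\<^esub>"
  by (auto simp: common_nb_def lam_eq cls_closed)

text \<open>One neighbour common to all three vertices computes all three values, and the factors of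
  the middle vertex cancel. This is the cocycle condition on a triangle.\<close>

lemma lam_trans:
  assumes "common_nb {a, b, c}"
  shows "lam a b \<otimes>\<^bsub>G\<^esub> lam b c = lam a c"
proof -
  obtain y where "(a, y) \<in> parcs H" "(b, y) \<in> parcs H" "(c, y) \<in> parcs H"
    using assms by (auto simp: common_nb_def)
  then show ?thesis
    by (simp add: lam_eq cls_closed G.m_assoc)
      (simp add: cls_closed flip: G.m_assoc[of "inv\<^bsub>G\<^esub> cls (b, y)"])
qed

lemma inv_lam: "common_nb {a, c} \<Longrightarrow> inv\<^bsub>G\<^esub> lam a c = lam c a"
  by (auto simp: common_nb_def lam_eq cls_closed G.inv_mult_group)

section \<open>Products of the cocycle along walks\<close>

definition lam_path :: "(nat \<Rightarrow> 'a) \<Rightarrow> nat \<Rightarrow> ('a \<times> 'a) word set" where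
  "lam_path \<alpha> k = G.lprod (map (\<lambda>i. lam (\<alpha> i) (\<alpha> (Suc i))) [0..<k])"

lemma lam_path_closed:
  "(\<And>i. i < k \<Longrightarrow> common_nb {\<alpha> i, \<alpha> (Suc i)}) \<Longrightarrow> lam_path \<alpha> k \<in> carrier G"
  unfolding lam_path_def by (intro G.lprod_closed) (auto intro: lam_closed)

lemma lam_path_Suc:
  assumes "\<And>i. i < Suc k \<Longrightarrow> common_nb {\<alpha> i, \<alpha> (Suc i)}"
  shows "lam_path \<alpha> (Suc k) = lam_path \<alpha> k \<otimes>\<^bsub>G\<^esub> lam (\<alpha> k) (\<alpha> (Suc k))"
proof -
  have "lam (\<alpha> i) (\<alpha> (Suc i)) \<in> carrier G" if "i < Suc k" for i
    using assms[OF that] by (rule lam_closed)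
  then show ?thesis
    unfolding lam_path_def by (auto simp: G.lprod_append image_subset_iff)
qed

text \<open>Discrete homotopy across a strip of squares: the two ways around each square agree by
  the cocycle condition, and the path is pushed over one square after another. The bound
  \<open>k \<ge> 1\<close> provides a square, which places the first rung in the group.\<close>

lemma lam_path_strip:
  assumes "\<And>i. i < k \<Longrightarrow> common_nb {\<alpha> i, \<alpha> (Suc i), \<beta> i, \<beta> (Suc i)}" "k \<ge> 1"
  shows "lam_path \<alpha> k \<otimes>\<^bsub>G\<^esub> lam (\<alpha> k) (\<beta> k) = lam (\<alpha> 0) (\<beta> 0) \<otimes>\<^bsub>G\<^esub> lam_path \<beta> k"
  using assms(2,1)
proof (induction k rule: nat_induct_at_least)
  case base
  then have c: "common_nb {\<alpha> 0, \<alpha> (Suc 0), \<beta> 0, \<beta> (Suc 0)}" by simp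
  have "lam (\<alpha> 0) (\<alpha> (Suc 0)) \<otimes>\<^bsub>G\<^esub> lam (\<alpha> (Suc 0)) (\<beta> (Suc 0))
      = lam (\<alpha> 0) (\<beta> 0) \<otimes>\<^bsub>G\<^esub> lam (\<beta> 0) (\<beta> (Suc 0))"
    by (subst (1 2) lam_trans) (auto intro: common_nb_mono[OF c])
  then show ?case
    using lam_closed[OF common_nb_mono[OF c]] by (simp add: lam_path_def)
next
  case (Suc k)
  note cell = Suc.prems
  have c: "common_nb {\<alpha> k, \<alpha> (Suc k), \<beta> k, \<beta> (Suc k)}" using cell by simp
  have ca: "common_nb {\<alpha> i, \<alpha> (Suc i)}" and cb: "common_nb {\<beta> i, \<beta> (Suc i)}"
    if "i < Suc k" for i
    using cell[OF that] by (auto intro: common_nb_mono)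
  have cl: "lam_path \<alpha> k \<in> carrier G" "lam_path \<beta> k \<in> carrier G"
    using ca cb by (auto intro!: lam_path_closed)
  have c0: "lam (\<alpha> 0) (\<beta> 0) \<in> carrier G"
    using cell[of 0] by (intro lam_closed) (auto intro: common_nb_mono)
  have lc: "lam (\<alpha> k) (\<alpha> (Suc k)) \<in> carrier G" "lam (\<alpha> (Suc k)) (\<beta> (Suc k)) \<in> carrier G"
    "lam (\<alpha> k) (\<beta> k) \<in> carrier G" "lam (\<beta> k) (\<beta> (Suc k)) \<in> carrier G"
    by (auto intro!: lam_closed intro: common_nb_mono[OF c])
  have "lam_path \<alpha> (Suc k) \<otimes>\<^bsub>G\<^esub> lam (\<alpha> (Suc k)) (\<beta> (Suc k))
      = lam_path \<alpha> k \<otimes>\<^bsub>G\<^esub> (lam (\<alpha> k) (\<alpha> (Suc k)) \<otimes>\<^bsub>G\<^esub> lam (\<alpha> (Suc k)) (\<beta> (Suc k)))"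
    using cl lc ca by (simp add: lam_path_Suc G.m_assoc)
  also have "lam (\<alpha> k) (\<alpha> (Suc k)) \<otimes>\<^bsub>G\<^esub> lam (\<alpha> (Suc k)) (\<beta> (Suc k))
      = lam (\<alpha> k) (\<beta> k) \<otimes>\<^bsub>G\<^esub> lam (\<beta> k) (\<beta> (Suc k))"
    by (subst (1 2) lam_trans) (auto intro: common_nb_mono[OF c])
  also have "lam_path \<alpha> k \<otimes>\<^bsub>G\<^esub> (lam (\<alpha> k) (\<beta> k) \<otimes>\<^bsub>G\<^esub> lam (\<beta> k) (\<beta> (Suc k)))
      = (lam_path \<alpha> k \<otimes>\<^bsub>G\<^esub> lam (\<alpha> k) (\<beta> k)) \<otimes>\<^bsub>G\<^esub> lam (\<beta> k) (\<beta> (Suc k))"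
    using cl lc by (simp add: G.m_assoc)
  also have "\<dots> = lam (\<alpha> 0) (\<beta> 0) \<otimes>\<^bsub>G\<^esub> lam_path \<beta> (Suc k)"
    using Suc.IH cell cl lc c0 cb by (simp add: lam_path_Suc G.m_assoc)
  finally show ?case .
qed

lemma inv_lam_path:
  assumes "\<And>i. i < k \<Longrightarrow> common_nb {\<alpha> i, \<alpha> (Suc i)}"
  shows "inv\<^bsub>G\<^esub> lam_path \<alpha> k = lam_path (\<lambda>i. \<alpha> (k - i)) k"
proof -
  have "set (map (\<lambda>i. lam (\<alpha> i) (\<alpha> (Suc i))) [0..<k]) \<subseteq> carrier G"
    using assms by (auto intro: lam_closed)
  moreover have "rev (map (\<lambda>x. inv\<^bsub>G\<^esub> x) (map (\<lambda>i. lam (\<alpha> i) (\<alpha> (Suc i))) [0..<k]))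
      = map (\<lambda>i. lam (\<alpha> (k - i)) (\<alpha> (k - Suc i))) [0..<k]"
  proof (rule nth_equalityI)
    fix i assume "i < length (rev (map (\<lambda>x. inv\<^bsub>G\<^esub> x) (map (\<lambda>i. lam (\<alpha> i) (\<alpha> (Suc i))) [0..<k])))"
    then have "i < k" by simp
    then show "rev (map (\<lambda>x. inv\<^bsub>G\<^esub> x) (map (\<lambda>i. lam (\<alpha> i) (\<alpha> (Suc i))) [0..<k])) ! i
        = map (\<lambda>i. lam (\<alpha> (k - i)) (\<alpha> (k - Suc i))) [0..<k] ! i"
      using assms[of "k - Suc i"] by (simp add: rev_nth inv_lam Suc_diff_Suc)
  qed simp
  ultimately show ?thesis
    unfolding lam_path_def by (simp add: G.inv_lprod)
qed

lemma signature_eq_lprod: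
  "signature H n f = G.lprod (map (\<lambda>i. cls (f (2 * i mod n), f ((2 * i + 1) mod n)) \<otimes>\<^bsub>G\<^esub>
      inv\<^bsub>G\<^esub> cls (f ((2 * i + 2) mod n), f ((2 * i + 1) mod n))) [0..<n])"
  by (simp add: signature_def G.lprod_def)

section \<open>From labelled grids to odd cycles\<close>

lemma hom_K2_swap: "p \<in> hom_K2 H \<Longrightarrow> prod.swap p \<in> hom_K2 H"
  by (auto simp: hom_K2_def intro: arc_sym)

definition rep :: "'a set \<times> 'a set \<Rightarrow> 'a" where
  "rep p = (SOME a. a \<in> fst p)"

lemma rep_in: "p \<in> hom_K2 H \<Longrightarrow> rep p \<in> fst p"
  unfolding rep_def by (rule someI_ex) (auto simp: hom_K2_def)

lemma rep_swap_in: "p \<in> hom_K2 H \<Longrightarrow> rep (prod.swap p) \<in> snd p"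
  using rep_in[OF hom_K2_swap] by simp

text \<open>Of two comparable elements the larger one contains both vertices, one on each side, and
  its sides are completely joined.\<close>

lemma rep_arc:
  assumes "p \<in> hom_K2 H" "q \<in> hom_K2 H" "p \<le> q \<or> q \<le> p"
  shows "(rep p, rep (prod.swap q)) \<in> parcs H"
proof -
  have "fst r \<times> snd r \<subseteq> parcs H" if "r \<in> hom_K2 H" for r
    using that by (cases r) (simp add: hom_K2_def)
  then have sub: "fst p \<times> snd p \<subseteq> parcs H" "fst q \<times> snd q \<subseteq> parcs H"
    using assms by blast+
  have "rep p \<in> fst p" "rep (prod.swap q) \<in> snd q"
    using assms rep_in rep_swap_in by blast+
  moreover have "fst p \<subseteq> fst q \<or> snd q \<subseteq> snd p"
    using assms(3) by (auto simp: less_eq_prod_def)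
  ultimately show ?thesis using sub by blast
qed

text \<open>For any fixed member \<open>q\<close> of the chain, the vertex
  \<open>rep (prod.swap q)\<close> is adjacent to all representatives by
  \<open>rep_arc\<close>.\<close>

lemma common_nb_chain:
  assumes "S \<subseteq> hom_K2 H" "S \<noteq> {}" "Complete_Partial_Order.chain (\<le>) S"
  shows "common_nb (rep ` S)"
proof -
  obtain q where "q \<in> S" using assms(2) by auto
  then have "(rep p, rep (prod.swap q)) \<in> parcs H" if "p \<in> S" for p
    using that assms by (intro rep_arc) (auto dest: chainD)
  then show ?thesis unfolding common_nb_def by blast
qed

text \<open>Write a_i and b_i for the representatives of the two sides of \<open>p i\<close>; then
  \<open>pm\<close> gives a_m = b_0 and b_m = a_0. The cycle is a_0, b_0, a_1, b_1, ..., b_(m-1),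
  a_m. Over two rounds its even positions run through a_0, ..., a_m and then b_0, ..., b_m, which
  yields the two factors.\<close>

lemma odd_cycle_of_walk:
  assumes p: "\<And>i. i \<le> m \<Longrightarrow> p i \<in> hom_K2 H"
    and step: "\<And>i. i < m \<Longrightarrow> p i \<le> p (Suc i) \<or> p (Suc i) \<le> p i"
    and pm: "p m = prod.swap (p 0)" and m: "m \<ge> 1"
  defines "f \<equiv> \<lambda>j. if even j then rep (p (j div 2)) else rep (prod.swap (p (j div 2)))"
  shows "graph_hom f (cycle_graph (2 * m + 1)) H"
    and "signature H (2 * m + 1) f
      = lam_path (\<lambda>i. rep (p i)) m \<otimes>\<^bsub>G\<^esub> lam_path (\<lambda>i. rep (prod.swap (p i))) m"
proof -
  define n where "n = 2 * m + 1"
  let ?a = "\<lambda>i. rep (p i)" and ?b = "\<lambda>i. rep (prod.swap (p i))"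
  have fe: "f (2 * i) = ?a i" and fo: "f (Suc (2 * i)) = ?b i" for i
    by (auto simp: f_def)
  have ab: "(?a i, ?b i) \<in> parcs H" if "i \<le> m" for i
    using p[OF that] by (intro rep_arc) auto
  have ba: "(?a (Suc i), ?b i) \<in> parcs H" if "i < m" for i
    using step[OF that] p that by (intro rep_arc) auto
  have bm: "?b m = ?a 0" and am: "?a m = ?b 0" by (auto simp: pm)
  have adj: "(f j, f (Suc j)) \<in> parcs H" if "j < 2 * m" for j
  proof (cases "even j")
    case True
    then obtain i where "j = 2 * i" by blast
    then show ?thesis using ab that by (simp add: fe fo)
  next
    case False
    then obtain i where j: "j = Suc (2 * i)" by (metis oddE Suc_eq_plus1)
    have "f (Suc j) = ?a (Suc i)" using fe[of "Suc i"] j by simp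
    then show ?thesis using ba[of i] that j by (auto simp: fo intro: arc_sym)
  qed
  have adj': "(f j, f (Suc j mod n)) \<in> parcs H" if "j < n" for j
  proof (cases "j = 2 * m")
    case True
    then show ?thesis using ab[of m] bm fe[of 0] by (simp add: n_def fe)
  next
    case False
    then show ?thesis using adj that by (simp add: n_def)
  qed
  show "graph_hom f (cycle_graph (2 * m + 1)) H"
    unfolding graph_hom_def n_def[symmetric]
  proof (intro conjI ballI)
    fix v assume "v \<in> pverts (cycle_graph n)"
    then show "f v \<in> pverts H"
      using adj'[of v] arc_verts by (auto simp: cycle_graph_def)
  next
    fix e assume "e \<in> parcs (cycle_graph n)"
    then show "case e of (u, v) \<Rightarrow> (f u, f v) \<in> parcs H"
      using adj' arc_sym by (auto simp: cycle_graph_def)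
  qed
  define t where "t i = cls (f (2 * i mod n), f ((2 * i + 1) mod n)) \<otimes>\<^bsub>G\<^esub>
      inv\<^bsub>G\<^esub> cls (f ((2 * i + 2) mod n), f ((2 * i + 1) mod n))" for i
  have t1: "t i = lam (?a i) (?a (Suc i))" if "i < m" for i
  proof -
    have "2 * i mod n = 2 * i" "(2 * i + 1) mod n = Suc (2 * i)" "(2 * i + 2) mod n = 2 * Suc i"
      using that by (auto simp: n_def)
    then have "t i = cls (?a i, ?b i) \<otimes>\<^bsub>G\<^esub> inv\<^bsub>G\<^esub> cls (?a (Suc i), ?b i)"
      unfolding t_def by (simp only: fe fo)
    then show ?thesis using lam_eq[OF ab[of i] ba[of i]] that by simp
  qed
  \<comment> \<open>The step from position \<open>2 * m\<close> to position 1 leads from the first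
    round to the second; both positions carry the vertex a_m = b_0, so the factor is
    trivial.\<close>
  have t2: "t m = \<one>\<^bsub>G\<^esub>"
  proof -
    have "2 * m mod n = 2 * m" "(2 * m + 1) mod n = 0" "(2 * m + 2) mod n = 1"
      using m by (auto simp: n_def mod_if)
    then have "t m = cls (?a m, ?a 0) \<otimes>\<^bsub>G\<^esub> inv\<^bsub>G\<^esub> cls (?b 0, ?a 0)"
      unfolding t_def using fe[of m] fe[of 0] fo[of 0] by simp
    then show ?thesis
      using ab[of 0] by (simp add: am cls_closed arc_sym)
  qed
  have t3: "t (Suc m + i) = lam (?b i) (?b (Suc i))" if "i < m" for i
  proof -
    have 1: "2 * (Suc m + i) mod n = Suc (2 * i)"
    proof -
      have "2 * (Suc m + i) = Suc (2 * i) + n" by (simp add: n_def)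
      then show ?thesis using that by (simp only: mod_add_self2) (simp add: n_def)
    qed
    have 2: "(2 * (Suc m + i) + 1) mod n = 2 * Suc i"
    proof -
      have "2 * (Suc m + i) + 1 = 2 * Suc i + n" by (simp add: n_def)
      then show ?thesis using that by (simp only: mod_add_self2) (simp add: n_def)
    qed
    have 3: "f ((2 * (Suc m + i) + 2) mod n) = ?b (Suc i)"
    proof (cases "Suc i = m")
      case True
      have "2 * (Suc m + i) + 2 = n + n" using True by (simp add: n_def)
      then have "(2 * (Suc m + i) + 2) mod n = 2 * 0" by (simp only:) simp
      then have "f ((2 * (Suc m + i) + 2) mod n) = ?a 0" by (simp only: fe)
      then show ?thesis using True bm by simp
    next
      case False
      have "2 * (Suc m + i) + 2 = Suc (2 * Suc i) + n" by (simp add: n_def)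
      then have "(2 * (Suc m + i) + 2) mod n = Suc (2 * Suc i)"
        using that False by (simp only: mod_add_self2) (simp add: n_def)
      then show ?thesis by (simp only: fo)
    qed
    have "t (Suc m + i) = cls (?b i, ?a (Suc i)) \<otimes>\<^bsub>G\<^esub> inv\<^bsub>G\<^esub> cls (?b (Suc i), ?a (Suc i))"
      unfolding t_def 1 2 3 by (simp only: fe fo)
    then show ?thesis
      using lam_eq[OF arc_sym[OF ba[of i]] arc_sym[OF ab[of "Suc i"]]] that by simp
  qed
  have "[0..<n] = [0..<m] @ [m] @ map (\<lambda>i. Suc m + i) [0..<m]"
    by (rule nth_equalityI) (auto simp: n_def nth_append nth_Cons')
  then have "map t [0..<n] = map (\<lambda>i. lam (?a i) (?a (Suc i))) [0..<m] @ [\<one>\<^bsub>G\<^esub>]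
      @ map (\<lambda>i. lam (?b i) (?b (Suc i))) [0..<m]"
    by (simp add: t1 t2 t3[simplified] comp_def)
  moreover have "set (map (\<lambda>i. lam (?a i) (?a (Suc i))) [0..<m]) \<subseteq> carrier G"
  proof -
    have "common_nb {?a i, ?a (Suc i)}" if "i < m" for i
      using ab[of i] ba[of i] that by (auto simp: common_nb_def)
    then show ?thesis by (auto intro: lam_closed)
  qed
  moreover have "set (map (\<lambda>i. lam (?b i) (?b (Suc i))) [0..<m]) \<subseteq> carrier G"
  proof -
    have "common_nb {?b i, ?b (Suc i)}" if "i < m" for i
      using ab[of "Suc i"] ba[of i] that by (auto simp: common_nb_def intro: arc_sym)
    then show ?thesis by (auto intro: lam_closed)
  qed
  ultimately have "G.lprod (map t [0..<n]) = lam_path ?a m \<otimes>\<^bsub>G\<^esub> lam_path ?b m"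
    unfolding lam_path_def by (simp add: G.lprod_append)
  then show "signature H (2 * m + 1) f = lam_path ?a m \<otimes>\<^bsub>G\<^esub> lam_path ?b m"
    unfolding signature_eq_lprod t_def n_def .
qed

text \<open>The grid models a closed hemisphere bounded by the bottom and the top row; the left and
  right sides collapse to two antipodal points. All rows have the same product by
  \<open>lam_path_strip\<close>. By \<open>top\<close>, the swapped bottom row is the top row read
  backwards, so the two factors of the signature are mutually inverse.\<close>

lemma odd_cycle_of_grid:
  assumes M: "M \<ge> 1"
    and p: "\<And>i j. i \<le> M \<Longrightarrow> j \<le> M \<Longrightarrow> p i j \<in> hom_K2 H"
    and cell: "\<And>i j. i < M \<Longrightarrow> j < M \<Longrightarrow>
      Complete_Partial_Order.chain (\<le>) {p i j, p (Suc i) j, p i (Suc j), p (Suc i) (Suc j)}"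
    and left: "\<And>j. j \<le> M \<Longrightarrow> p 0 j = p 0 0"
    and right: "\<And>j. j \<le> M \<Longrightarrow> p M j = p M 0"
    and top: "\<And>i. i \<le> M \<Longrightarrow> p i M = prod.swap (p (M - i) 0)"
  shows "\<exists>n f. odd n \<and> n \<ge> 3 \<and> graph_hom f (cycle_graph n) H \<and> signature H n f = \<one>\<^bsub>G\<^esub>"
proof -
  let ?a = "\<lambda>j i. rep (p i j)"
  have nb: "common_nb {?a j i, ?a j (Suc i), ?a (Suc j) i, ?a (Suc j) (Suc i)}"
    if "i < M" "j < M" for i j
    using common_nb_chain[OF _ _ cell[OF that]] p that by simp
  have nb1: "common_nb {?a j i, ?a j (Suc i)}" if "i < M" "j \<le> M" for i j
  proof (cases "j = M")
    case True
    then obtain j' where "j = Suc j'" using M by (cases j) auto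
    then show ?thesis using nb[of i j'] that by (auto intro: common_nb_mono)
  next
    case False
    then show ?thesis using nb[of i j] that by (auto intro: common_nb_mono)
  qed
  have rows: "lam_path (?a j) M = lam_path (?a 0) M" if "j \<le> M" for j
    using that
  proof (induction j)
    case (Suc j)
    have "lam_path (?a j) M \<otimes>\<^bsub>G\<^esub> lam (?a j M) (?a (Suc j) M)
        = lam (?a j 0) (?a (Suc j) 0) \<otimes>\<^bsub>G\<^esub> lam_path (?a (Suc j)) M"
      using nb Suc.prems M by (intro lam_path_strip) auto
    moreover have "?a j M = ?a (Suc j) M" "?a j 0 = ?a (Suc j) 0"
      using left[of j] left[of "Suc j"] right[of j] right[of "Suc j"] Suc.prems by auto
    moreover have "common_nb {?a (Suc j) M}" "common_nb {?a (Suc j) 0}"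
      using nb1[of "M - 1" "Suc j"] nb1[of 0 "Suc j"] M Suc.prems
      by (auto intro: common_nb_mono)
    moreover have "lam_path (?a j) M \<in> carrier G" "lam_path (?a (Suc j)) M \<in> carrier G"
      using nb1 Suc.prems by (auto intro!: lam_path_closed)
    ultimately have "lam_path (?a j) M = lam_path (?a (Suc j)) M"
      by (simp add: lam_refl)
    then show ?case using Suc by simp
  qed simp
  let ?f = "\<lambda>j. if even j then rep (p (j div 2) 0) else rep (prod.swap (p (j div 2) 0))"
  have step: "p i 0 \<le> p (Suc i) 0 \<or> p (Suc i) 0 \<le> p i 0" if "i < M" for i
    using chainD[OF cell[of i 0], of "p i 0" "p (Suc i) 0"] that M by simp
  have pM: "p M 0 = prod.swap (p 0 0)"
    using top[of M] right[of M] by simp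
  note walk = odd_cycle_of_walk[of M "\<lambda>i. p i 0", OF _ step pM M]
  have hom: "graph_hom ?f (cycle_graph (2 * M + 1)) H"
    using walk(1) p by simp
  have "signature H (2 * M + 1) ?f
      = lam_path (?a 0) M \<otimes>\<^bsub>G\<^esub> lam_path (\<lambda>i. rep (prod.swap (p i 0))) M"
    using walk(2) p by simp
  also have "lam_path (\<lambda>i. rep (prod.swap (p i 0))) M = lam_path (\<lambda>i. ?a M (M - i)) M"
    unfolding lam_path_def using top by (intro arg_cong[of _ _ G.lprod] map_cong) auto
  also have "\<dots> = inv\<^bsub>G\<^esub> lam_path (?a M) M"
    using nb1[of _ M] by (intro inv_lam_path[symmetric]) auto
  also have "lam_path (?a M) M = lam_path (?a 0) M"
    by (rule rows) simp
  finally have "signature H (2 * M + 1) ?f = \<one>\<^bsub>G\<^esub>"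
    using nb1[of _ 0] by (simp add: lam_path_closed G.r_inv)
  then show ?thesis
    using hom M by (intro exI[of _ "2 * M + 1"] exI[of _ ?f]) auto
qed

section \<open>From equivariant maps to labelled grids\<close>


definition X :: "('a set \<times> 'a set \<Rightarrow> real) set" where
  "X = {t. (\<forall>p. 0 \<le> t p) \<and> {p. t p \<noteq> 0} \<in> order_complex (hom_K2 H) \<and> (\<Sum>p | t p \<noteq> 0. t p) = 1}"

text \<open>Passing from the abstract topology to a subset of a topological type makes
  \<open>continuous_on\<close> and \<open>homotopic_paths\<close> applicable.\<close>

lemma hom_K2_space_eq: "hom_K2_space H = top_of_set X"
  by (simp add: hom_K2_space_def geometric_realization_def X_def euclidean_product_topology)

lemma X_support_nonempty: "t \<in> X \<Longrightarrow> \<exists>p. t p > 0"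
  by (auto simp: X_def order_complex_def less_le)

lemma X_support: "t \<in> X \<Longrightarrow> t p > 0 \<Longrightarrow> p \<in> hom_K2 H"
  by (auto simp: X_def order_complex_def)

lemma X_support_chain:
  assumes "t \<in> X" "\<And>p. p \<in> S \<Longrightarrow> t p > 0"
  shows "Complete_Partial_Order.chain (\<le>) S"
proof (rule chain_subset)
  show "Complete_Partial_Order.chain (\<le>) {p. t p \<noteq> 0}"
    using assms(1) by (simp add: X_def order_complex_def)
  show "S \<subseteq> {p. t p \<noteq> 0}"
  proof
    fix p assume "p \<in> S"
    then have "t p > 0" by (rule assms(2))
    then show "p \<in> {p. t p \<noteq> 0}" by simp
  qed
qed

section \<open>An equivariant labelling of the sphere\<close>

definition lex_pos :: "real \<times> real \<times> real \<Rightarrow> bool" where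
  "lex_pos v = (case v of (x, y, z) \<Rightarrow> x > 0 \<or> x = 0 \<and> (y > 0 \<or> y = 0 \<and> z > 0))"

text \<open>Serves to pick one point of each antipodal pair, on which labels can be chosen freely
  before the swap transfers them to the other point.\<close>

lemma lex_pos_uminus: "v \<noteq> 0 \<Longrightarrow> lex_pos (- v) \<longleftrightarrow> \<not> lex_pos v"
  by (cases v) (auto simp: lex_pos_def zero_prod_def)

text \<open>The sets where a coordinate of \<open>g\<close> is positive are preimages of open stars
  of vertices and cover the sphere. With a Lebesgue number \<open>e\<close> of this cover, the label
  of \<open>v\<close> is a vertex whose star contains the image of the \<open>e\<close>-ball around
  \<open>v\<close>. Labels of points near \<open>u\<close> thus lie in the support of
  \<open>g u\<close>, which is a chain.\<close>

lemma equivariant_labelling: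
  fixes g :: "real \<times> real \<times> real \<Rightarrow> 'a set \<times> 'a set \<Rightarrow> real"
  assumes cont: "continuous_on (sphere 0 1) g" and gX: "g ` sphere 0 1 \<subseteq> X"
    and anti: "\<And>v. v \<in> sphere 0 1 \<Longrightarrow> g (- v) = hom_K2_involution (g v)"
  obtains l e where "e > 0"
    "\<And>u v. u \<in> sphere 0 1 \<Longrightarrow> v \<in> sphere 0 1 \<Longrightarrow> dist u v < e \<Longrightarrow> g u (l v) > 0"
    "\<And>v. v \<in> sphere 0 1 \<Longrightarrow> l (- v) = prod.swap (l v)"
proof -
  let ?S = "sphere (0 :: real \<times> real \<times> real) 1"
  have "open {t :: 'a set \<times> 'a set \<Rightarrow> real. 0 < t p}" for p
    by (intro open_Collect_less continuous_on_const continuous_on_product_coordinates)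
  then have "\<forall>p. \<exists>A. open A \<and> A \<inter> ?S = g -` {t. 0 < t p} \<inter> ?S"
    using cont unfolding continuous_on_open_invariant by blast
  then obtain A where A: "\<And>p. open (A p)" "\<And>p. A p \<inter> ?S = g -` {t. 0 < t p} \<inter> ?S"
    by metis
  have cover: "?S \<subseteq> \<Union>(range A)"
  proof
    fix v assume v: "v \<in> ?S"
    then obtain p where "g v p > 0" using gX X_support_nonempty by blast
    then have "v \<in> A p" using A(2)[of p] v by blast
    then show "v \<in> \<Union>(range A)" by blast
  qed
  obtain e where e: "e > 0" "\<And>v. v \<in> ?S \<Longrightarrow> \<exists>B\<in>range A. ball v e \<subseteq> B"
    by (rule Heine_Borel_lemma[OF compact_sphere cover]) (use A(1) in auto)
  then have "\<forall>v\<in>?S. \<exists>p. ball v e \<subseteq> A p" by blast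
  then obtain c where c: "\<And>v. v \<in> ?S \<Longrightarrow> ball v e \<subseteq> A (c v)" by metis
  have c_pos: "g u (c v) > 0" if "u \<in> ?S" "v \<in> ?S" "dist u v < e" for u v
  proof -
    have "u \<in> A (c v)" using c[OF that(2)] that(3) by (auto simp: dist_commute)
    then show ?thesis using A(2)[of "c v"] that(1) by blast
  qed
  define l where "l v = (if lex_pos v then c v else prod.swap (c (- v)))" for v
  show thesis
  proof
    show "e > 0" by fact
    fix v assume v: "v \<in> ?S"
    then have "v \<noteq> 0" by auto
    then show "l (- v) = prod.swap (l v)"
      using lex_pos_uminus[of v] by (auto simp: l_def)
    fix u assume u: "u \<in> ?S" and d: "dist u v < e"
    show "g u (l v) > 0"
    proof (cases "lex_pos v")
      case True
      then show ?thesis using c_pos u v d by (simp add: l_def)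
    next
      case False
      \<comment> \<open>Here the label comes from \<open>- v\<close>, and \<open>- u\<close> is
        within \<open>e\<close> of that point; \<open>anti\<close> carries the coordinate back to
        \<open>g u\<close>.\<close>
      have "g (- u) (c (- v)) > 0"
        using u v d by (intro c_pos) (auto simp: dist_minus)
      then show ?thesis
        using False anti[OF u] by (simp add: l_def hom_K2_involution_def)
    qed
  qed
qed

section \<open>A grid in spherical coordinates\<close>

lemma norm_triple: "norm (x :: real, y :: real, z :: real) = sqrt (x\<^sup>2 + y\<^sup>2 + z\<^sup>2)"
  by (simp add: norm_Pair add.assoc)

lemma odd_cycle_of_equivariant_map:
  fixes g :: "real \<times> real \<times> real \<Rightarrow> 'a set \<times> 'a set \<Rightarrow> real"
  assumes cont: "continuous_on (sphere 0 1) g" and gX: "g ` sphere 0 1 \<subseteq> X"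
    and anti: "\<And>v. v \<in> sphere 0 1 \<Longrightarrow> g (- v) = hom_K2_involution (g v)"
  shows "\<exists>n f. odd n \<and> n \<ge> 3 \<and> graph_hom f (cycle_graph n) H \<and> signature H n f = \<one>\<^bsub>G\<^esub>"
proof -
  obtain l e where e: "e > 0"
    and pos: "\<And>u v. u \<in> sphere 0 1 \<Longrightarrow> v \<in> sphere 0 1 \<Longrightarrow> dist u v < e \<Longrightarrow> g u (l v) > 0"
    and l_swap: "\<And>v. v \<in> sphere 0 1 \<Longrightarrow> l (- v) = prod.swap (l v)"
    by (rule equivariant_labelling[OF cont gX], erule anti, rule that)
  \<comment> \<open>Spherical coordinates around the first axis: the sides \<open>s = 0\<close> and
    \<open>s = 1\<close> go to the poles, and \<open>t = 0\<close> and \<open>t = 1\<close> to the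
    two halves of a great circle through them, so the square covers a closed hemisphere.\<close>
  define \<phi> :: "real \<times> real \<Rightarrow> real \<times> real \<times> real" where
    "\<phi> = (\<lambda>(s, t). (cos (pi * s), sin (pi * s) * cos (pi * t), sin (pi * s) * sin (pi * t)))"
  have sph: "\<phi> z \<in> sphere 0 1" for z
  proof (cases z)
    case (Pair s t)
    have "(cos (pi * s))\<^sup>2 + (sin (pi * s) * cos (pi * t))\<^sup>2 + (sin (pi * s) * sin (pi * t))\<^sup>2
        = (cos (pi * s))\<^sup>2 + (sin (pi * s))\<^sup>2 * ((cos (pi * t))\<^sup>2 + (sin (pi * t))\<^sup>2)"
      by (simp only: power_mult_distrib distrib_left add.assoc)
    also have "\<dots> = 1" by simp
    finally show ?thesis by (simp add: Pair \<phi>_def norm_triple)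
  qed
  have "continuous_on ({0..1} \<times> {0..1}) \<phi>"
    unfolding \<phi>_def case_prod_unfold by (intro continuous_intros)
  then have "uniformly_continuous_on ({0..1} \<times> {0..1}) \<phi>"
    by (intro compact_uniformly_continuous compact_Times) auto
  then obtain d where d: "d > 0" "\<And>z z'. z \<in> {0..1} \<times> {0..1} \<Longrightarrow> z' \<in> {0..1} \<times> {0..1} \<Longrightarrow>
      dist z' z < d \<Longrightarrow> dist (\<phi> z') (\<phi> z) < e"
    unfolding uniformly_continuous_on_def using e by blast
  \<comment> \<open>Two corners of a cell differ by at most \<open>1 / M\<close> in each coordinate,
    hence by at most \<open>2 / M\<close> in distance.\<close>
  obtain M :: nat where M: "M > 2 / d" using reals_Archimedean2 by blast
  then have M0: "M \<ge> 1" using d(1) by (cases M) (auto simp: field_simps)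
  have Md: "2 / M < d" using M d(1) M0 by (simp add: field_simps)
  define z where "z i j = (real i / M, real j / M)" for i j
  define p where "p i j = l (\<phi> (z i j))" for i j
  have z01: "z i j \<in> {0..1} \<times> {0..1}" if "i \<le> M" "j \<le> M" for i j
    using that M0 by (auto simp: z_def field_simps)
  have near: "dist (\<phi> (z i j)) (\<phi> (z i' j')) < e"
    if "i < M" "j < M" "i' \<in> {i, Suc i}" "j' \<in> {j, Suc j}" for i j i' j'
  proof (rule d(2))
    have 1: "\<bar>real a / M - real a' / M\<bar> \<le> 1 / M" if "a' \<in> {a, Suc a}" for a a'
      using that M0 by (auto simp: field_simps)
    have "dist (z i j) (z i' j') \<le> \<bar>real i / M - real i' / M\<bar> + \<bar>real j / M - real j' / M\<bar>"
      unfolding z_def dist_Pair_Pair dist_real_def by (rule sqrt_sum_squares_le_sum_abs[THEN order_trans]) simp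
    also have "\<dots> \<le> 1 / M + 1 / M" using that 1 by (intro add_mono) auto
    also have "\<dots> < d" using Md by simp
    finally show "dist (z i j) (z i' j') < d" .
  qed (use that z01 in auto)
  have in_X: "g (\<phi> y) \<in> X" for y using gX sph by blast
  have pP: "p i j \<in> hom_K2 H" for i j
    unfolding p_def by (rule X_support[OF in_X[of "z i j"] pos[OF sph sph]]) (simp add: e)
  \<comment> \<open>The single point \<open>g (\<phi> (z i j))\<close>, from one corner of the cell,
    has all four labels in its support.\<close>
  have chain: "Complete_Partial_Order.chain (\<le>) {p i j, p (Suc i) j, p i (Suc j), p (Suc i) (Suc j)}"
    if "i < M" "j < M" for i j
  proof (rule X_support_chain)
    show "g (\<phi> (z i j)) \<in> X" by (rule in_X)
    have *: "g (\<phi> (z i j)) (p i' j') > 0" if "i' \<in> {i, Suc i}" "j' \<in> {j, Suc j}" for i' j'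
      unfolding p_def by (rule pos[OF sph sph near[OF \<open>i < M\<close> \<open>j < M\<close> that]])
    show "g (\<phi> (z i j)) q > 0" if "q \<in> {p i j, p (Suc i) j, p i (Suc j), p (Suc i) (Suc j)}" for q
      using that *[of i j] *[of "Suc i" j] *[of i "Suc j"] *[of "Suc i" "Suc j"] by fastforce
  qed
  have left: "p 0 j = p 0 0" and right: "p M j = p M 0" for j
    using M0 by (auto simp: p_def z_def \<phi>_def)
  have top: "p i M = prod.swap (p (M - i) 0)" if "i \<le> M" for i
  proof -
    have "real (M - i) / M = 1 - real i / M" using that M0 by (simp add: of_nat_diff field_simps)
    then have "\<phi> (z i M) = - \<phi> (z (M - i) 0)"
      using M0 by (simp add: z_def \<phi>_def right_diff_distrib)
    then show ?thesis using l_swap[OF sph, of "z (M - i) 0"] by (simp add: p_def)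
  qed
  show ?thesis
    using M0 pP chain left right top by (intro odd_cycle_of_grid[of M p])
qed

section \<open>Restriction to a great 2-sphere\<close>

definition embed3 :: "real \<times> real \<times> real \<Rightarrow> nat \<Rightarrow> real" where
  "embed3 v i = (if i = 0 then fst v else if i = 1 then fst (snd v) else if i = 2 then snd (snd v) else 0)"

lemma sum_embed3: "k \<ge> 2 \<Longrightarrow> (\<Sum>i\<le>k. (embed3 v i)\<^sup>2) = (fst v)\<^sup>2 + (fst (snd v))\<^sup>2 + (snd (snd v))\<^sup>2"
proof -
  assume k: "k \<ge> 2"
  have "(\<Sum>i\<le>k. (embed3 v i)\<^sup>2) = (\<Sum>i\<in>{0, 1, 2}. (embed3 v i)\<^sup>2)"
    using k by (intro sum.mono_neutral_right) (auto simp: embed3_def)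
  then show ?thesis by (simp add: embed3_def)
qed

lemma continuous_map_embed3:
  assumes "k \<ge> 2"
  shows "continuous_map (top_of_set (sphere 0 1)) (nsphere k) embed3"
  unfolding nsphere
proof (rule continuous_map_into_subtopology)
  show "continuous_map (top_of_set (sphere 0 1)) (powertop_real UNIV) embed3"
  proof -
    have "continuous_on (sphere 0 1) (\<lambda>v. embed3 v i)" for i
      unfolding embed3_def
      by (cases "i = 0"; cases "i = 1"; cases "i = 2") (auto intro!: continuous_intros)
    then show ?thesis by (simp add: continuous_map_componentwise_UNIV)
  qed
  show "embed3 \<in> topspace (top_of_set (sphere 0 1)) \<rightarrow> {x. (\<Sum>i\<le>k. (x i)\<^sup>2) = 1 \<and> (\<forall>i>k. x i = 0)}"
  proof
    fix v :: "real \<times> real \<times> real" assume "v \<in> topspace (top_of_set (sphere 0 1))"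
    then have "(fst v)\<^sup>2 + (fst (snd v))\<^sup>2 + (snd (snd v))\<^sup>2 = 1"
      by (cases v) (simp add: norm_triple)
    then show "embed3 v \<in> {x. (\<Sum>i\<le>k. (x i)\<^sup>2) = 1 \<and> (\<forall>i>k. x i = 0)}"
      using assms by (auto simp: sum_embed3) (simp add: embed3_def)
  qed
qed

text \<open>The coindex is a supremum, so the bound yields an equivariant map from some sphere of
  dimension \<open>k \<ge> 2\<close>; composing with the odd map \<open>embed3\<close> restricts it
  to a great 2-sphere.\<close>

theorem coind_ge_2_imp_odd_cycle:
  assumes "coind (hom_K2_space H) hom_K2_involution \<ge> 2"
  shows "\<exists>n f. odd n \<and> n \<ge> 3 \<and> graph_hom f (cycle_graph n) H \<and> signature H n f = \<one>\<^bsub>G\<^esub>"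
proof -
  let ?K = "{k. \<exists>g. continuous_map (nsphere k) (hom_K2_space H) g \<and>
    (\<forall>x\<in>topspace (nsphere k). g (\<lambda>i. - x i) = hom_K2_involution (g x))}"
  have "\<exists>k\<in>?K. k \<ge> 2"
  proof (rule ccontr)
    assume "\<not> (\<exists>k\<in>?K. k \<ge> 2)"
    then have "ereal (real k) \<le> 1" if "k \<in> ?K" for k
    proof -
      have "k < 2" using that \<open>\<not> (\<exists>k\<in>?K. k \<ge> 2)\<close> by (meson not_le)
      then show ?thesis by (simp add: one_ereal_def)
    qed
    then have "coind (hom_K2_space H) hom_K2_involution \<le> 1"
      unfolding coind_def by (rule SUP_least)
    then have "(2 :: ereal) \<le> 1" using assms by (rule order_trans[rotated])
    then show False by simp
  qed
  then obtain k g where k: "k \<ge> 2" and g: "continuous_map (nsphere k) (hom_K2_space H) g"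
    and anti: "\<And>x. x \<in> topspace (nsphere k) \<Longrightarrow> g (\<lambda>i. - x i) = hom_K2_involution (g x)"
    by blast
  have "continuous_map (top_of_set (sphere 0 1)) (top_of_set X) (g \<circ> embed3)"
    using continuous_map_compose[OF continuous_map_embed3[OF k] g] by (simp add: hom_K2_space_eq)
  then have "continuous_on (sphere 0 1) (g \<circ> embed3)" "(g \<circ> embed3) ` sphere 0 1 \<subseteq> X"
    by (auto simp: image_subset_iff_funcset)
  moreover have "(g \<circ> embed3) (- v) = hom_K2_involution ((g \<circ> embed3) v)" if "v \<in> sphere 0 1" for v
  proof -
    have "embed3 v \<in> topspace (nsphere k)"
      using continuous_map_embed3[OF k] that by (auto simp: continuous_map_def)
    moreover have "embed3 (- v) = (\<lambda>i. - embed3 v i)"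
      by (auto simp: embed3_def)
    ultimately show ?thesis using anti by simp
  qed
  ultimately show ?thesis by (rule odd_cycle_of_equivariant_map)
qed

section \<open>Edge paths in the hom-complex\<close>

text \<open>
  The elements of the poset below a given one span a cone, so the bounded sets, rather than only the
  chains, serve as simplices.
\<close>

definition bounded_in :: "('a set \<times> 'a set) set \<Rightarrow> bool" where
  "bounded_in S \<longleftrightarrow> S \<subseteq> hom_K2 H \<and> (\<exists>q\<in>hom_K2 H. \<forall>p\<in>S. p \<le> q)"

definition edge_path :: "('a set \<times> 'a set) list \<Rightarrow> bool" where
  "edge_path u \<longleftrightarrow> u \<noteq> [] \<and> set u \<subseteq> hom_K2 H \<and> successively (\<lambda>p q. bounded_in {p, q}) u"

lemma bounded_in_single: "p \<in> hom_K2 H \<Longrightarrow> bounded_in {p}"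
  by (auto simp: bounded_in_def)

lemma edge_path_single [simp]: "edge_path [p] \<longleftrightarrow> p \<in> hom_K2 H"
  by (simp add: edge_path_def)

lemma edge_path_Cons:
  "edge_path (p # q # u) \<longleftrightarrow> p \<in> hom_K2 H \<and> bounded_in {p, q} \<and> edge_path (q # u)"
  by (auto simp: edge_path_def)

lemma edge_path_append:
  assumes "u \<noteq> []" "v \<noteq> []"
  shows "edge_path (u @ v) \<longleftrightarrow> edge_path u \<and> edge_path v \<and> bounded_in {last u, hd v}"
  using assms by (auto simp: edge_path_def successively_append_iff)

lemma edge_path_rev: "edge_path (rev u) \<longleftrightarrow> edge_path u"
proof -
  have "successively (\<lambda>p q. bounded_in {q, p}) u \<longleftrightarrow> successively (\<lambda>p q. bounded_in {p, q}) u"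
    by (simp add: insert_commute)
  then show ?thesis by (simp only: edge_path_def successively_rev set_rev rev_is_Nil_conv)
qed

text \<open>The elementary homotopies of edge paths in the complex of bounded sets, with endpoints
  kept fixed. The relation is defined on all lists; \<open>eqv_invariants\<close> shows that it
  preserves edge paths.\<close>

inductive eqv :: "('a set \<times> 'a set) list \<Rightarrow> ('a set \<times> 'a set) list \<Rightarrow> bool" (infix "\<asymp>" 50) where
  eqv_refl: "u \<asymp> u"
| eqv_sym: "u \<asymp> v \<Longrightarrow> v \<asymp> u"
| eqv_trans: "u \<asymp> v \<Longrightarrow> v \<asymp> w \<Longrightarrow> u \<asymp> w"
| eqv_stutter: "xs @ a # a # ys \<asymp> xs @ a # ys"
| eqv_triangle: "bounded_in {a, b, c} \<Longrightarrow> xs @ a # b # c # ys \<asymp> xs @ a # c # ys"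

declare eqv_refl [simp] eqv_trans [trans]

lemma eqv_context: "u \<asymp> v \<Longrightarrow> xs @ u @ ys \<asymp> xs @ v @ ys"
proof (induction rule: eqv.induct)
  case (eqv_stutter us a vs)
  then show ?case using eqv.eqv_stutter[of "xs @ us" a "vs @ ys"] by simp
next
  case (eqv_triangle a b c us vs)
  then show ?case using eqv.eqv_triangle[of a b c "xs @ us" "vs @ ys"] by simp
qed (auto intro: eqv_sym eqv_trans)

lemma eqv_append: "u \<asymp> u' \<Longrightarrow> v \<asymp> v' \<Longrightarrow> u @ v \<asymp> u' @ v'"
  using eqv_context[of u u' "[]" v] eqv_context[of v v' u' "[]"] by (auto intro: eqv_trans)

lemma eqv_stutter_Cons: "v \<noteq> [] \<Longrightarrow> hd v = a \<Longrightarrow> xs @ a # v \<asymp> xs @ v"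
  using eqv_stutter[of xs a "tl v"] by (cases v) auto

lemma eqv_stutter_snoc: "u \<noteq> [] \<Longrightarrow> last u = a \<Longrightarrow> u @ a # ys \<asymp> u @ ys"
  using eqv_stutter[of "butlast u" a ys] append_butlast_last_id[of u] by (metis append.assoc append_Cons append_Nil)

lemma eqv_triangle': "bounded_in {last u, b, hd v} \<Longrightarrow> u \<noteq> [] \<Longrightarrow> v \<noteq> [] \<Longrightarrow> u @ b # v \<asymp> u @ v"
  using eqv_triangle[of "last u" b "hd v" "butlast u" "tl v"] append_butlast_last_id[of u]
  by (metis append.assoc append_Cons append_Nil list.collapse)

text \<open>The innermost turn is removed first: the induction hypothesis leaves
  \<open>a, b, a\<close>, a degenerate triangle on the edge from \<open>a\<close> to
  \<open>b\<close>, which then shrinks to \<open>a\<close>.\<close>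

lemma eqv_cancel: "edge_path u \<Longrightarrow> u @ rev u \<asymp> [hd u]"
proof (induction u)
  case (Cons a u)
  show ?case
  proof (cases u)
    case Nil
    then show ?thesis using eqv_stutter[of "[]" a "[]"] by simp
  next
    case (Cons b w)
    have "edge_path u" and ab: "bounded_in {a, b, a}"
      using Cons.prems by (auto simp: Cons edge_path_Cons insert_commute)
    then have "[a] @ (u @ rev u) @ [a] \<asymp> [a] @ [b] @ [a]"
      using Cons.IH by (intro eqv_context) (simp add: Cons)
    also have "[a] @ [b] @ [a] \<asymp> [a, a]"
      using eqv_triangle[OF ab, of "[]" "[]"] by simp
    also have "[a, a] \<asymp> [a]"
      using eqv_stutter[of "[]" a "[]"] by simp
    finally show ?thesis by simp
  qed
qed (simp add: edge_path_def)

lemma eqv_cancel': "edge_path u \<Longrightarrow> rev u @ u \<asymp> [last u]"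
  using eqv_cancel[of "rev u"] by (simp add: edge_path_rev hd_rev)

text \<open>The last conjunct is an equivalence so that the induction passes through
  \<open>eqv_sym\<close>. In the triangle case all faces of the bounded set are bounded, so
  \<open>b\<close> can be inserted as well as removed.\<close>

lemma eqv_invariants:
  assumes "u \<asymp> v"
  shows "(u = [] \<longleftrightarrow> v = []) \<and> hd u = hd v \<and> last u = last v \<and> (edge_path u \<longleftrightarrow> edge_path v)"
  using assms
proof (induction rule: eqv.induct)
  case (eqv_stutter xs a ys)
  have "edge_path (a # a # ys) \<longleftrightarrow> edge_path (a # ys)"
    by (auto simp: edge_path_Cons bounded_in_single edge_path_def)
  then show ?case by (cases xs) (auto simp: edge_path_append simp flip: append_Cons)
next
  case (eqv_triangle a b c xs ys)
  then have "bounded_in {a, b}" "bounded_in {b, c}" "bounded_in {a, c}" "b \<in> hom_K2 H"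
    by (auto simp: bounded_in_def)
  then have "edge_path (a # b # c # ys) \<longleftrightarrow> edge_path (a # c # ys)"
    by (auto simp: edge_path_Cons)
  then show ?case by (cases xs) (auto simp: edge_path_append simp flip: append_Cons)
qed auto

section \<open>Words and loops\<close>

definition pt :: "'a \<times> 'a \<Rightarrow> 'a set \<times> 'a set" where
  "pt e = ({fst e}, {snd e})"

lemma pt_in: "e \<in> parcs H \<Longrightarrow> pt e \<in> hom_K2 H"
  using arc_verts[of "fst e" "snd e"] by (auto simp: pt_def hom_K2_def)

text \<open>The complete bipartite pair \<open>(A, B)\<close> is itself an element of the poset, and
  it lies above all of its arcs.\<close>

lemma bounded_in_pt:
  assumes "A \<times> B \<subseteq> parcs H" "E \<subseteq> A \<times> B" "E \<noteq> {}"
  shows "bounded_in (pt ` E)"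
proof -
  have "pt ` E \<subseteq> hom_K2 H" using assms pt_in by blast
  moreover
  have "(A, B) \<in> hom_K2 H"
    using assms arc_verts unfolding hom_K2_def by blast
  ultimately show ?thesis
    unfolding bounded_in_def using assms(2) by (intro conjI bexI[of _ "(A, B)"]) (auto simp: pt_def)
qed

lemma bounded_in_pt_fst:
  assumes "(a, b) \<in> parcs H" "(a, c) \<in> parcs H" "(a, d) \<in> parcs H"
  shows "bounded_in {pt (a, b), pt (a, c), pt (a, d)}"
  using bounded_in_pt[of "{a}" "{b, c, d}" "{(a, b), (a, c), (a, d)}"] assms by simp

lemma bounded_in_pt_snd:
  assumes "(a, d) \<in> parcs H" "(b, d) \<in> parcs H" "(c, d) \<in> parcs H"
  shows "bounded_in {pt (a, d), pt (b, d), pt (c, d)}"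
  using bounded_in_pt[of "{a, b, c}" "{d}" "{(a, d), (b, d), (c, d)}"] assms by simp

text \<open>The square of arcs of a 4-cycle is cut into two triangles by the diagonal from
  \<open>(a, b)\<close> to \<open>(c, d)\<close>.\<close>

lemma bounded_in_pt_pair:
  assumes "(a, b) \<in> parcs H" "(a, d) \<in> parcs H" "(c, b) \<in> parcs H" "(c, d) \<in> parcs H"
  shows "bounded_in {pt (a, b), pt (c, b), pt (c, d)}" "bounded_in {pt (a, b), pt (c, d), pt (a, d)}"
  using bounded_in_pt[of "{a, c}" "{b, d}" "{(a, b), (c, b), (c, d)}"]
    bounded_in_pt[of "{a, c}" "{b, d}" "{(a, b), (c, d), (a, d)}"] assms by auto

end

section \<open>Paths from a base arc and the loops of arcs\<close>

locale based_arc_graph = arc_graph +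
  fixes e0 :: "'a \<times> 'a"
  assumes e0: "e0 \<in> parcs H"
begin

text \<open>The end may be any arc with tail \<open>a\<close>, since all of these lie below one
  element of the poset.\<close>

definition tail_path :: "'a \<Rightarrow> ('a set \<times> 'a set) list \<Rightarrow> bool" where
  "tail_path a t \<longleftrightarrow> edge_path t \<and> hd t = pt e0 \<and> (\<exists>b. (a, b) \<in> parcs H \<and> last t = pt (a, b))"

definition reach :: "'a \<Rightarrow> bool" where
  "reach a \<longleftrightarrow> (\<exists>t. tail_path a t)"

text \<open>The constant path is prescribed at \<open>fst e0\<close>, so that the loop of the
  signature returns to the base point without a detour.\<close>

definition T :: "'a \<Rightarrow> ('a set \<times> 'a set) list" where
  "T a = (if a = fst e0 then [pt e0] else SOME t. tail_path a t)"

lemma pt_e0_ends: "\<exists>b. (fst e0, b) \<in> parcs H \<and> pt e0 = pt (fst e0, b)"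
  using e0 by (intro exI[of _ "snd e0"]) simp

lemma tail_path_T: "reach a \<Longrightarrow> tail_path a (T a)"
proof (cases "a = fst e0")
  case True
  then show ?thesis
    unfolding tail_path_def T_def using pt_in[OF e0] pt_e0_ends by simp
next
  case False
  then show "reach a \<Longrightarrow> ?thesis" by (auto simp: T_def reach_def intro: someI)
qed

lemma reach_e0: "reach (fst e0)"
  unfolding reach_def tail_path_def using pt_in[OF e0] pt_e0_ends
  by (intro exI[of _ "[pt e0]"]) simp

lemma T_nonempty: "reach a \<Longrightarrow> T a \<noteq> []"
  using tail_path_T by (auto simp: tail_path_def edge_path_def)

lemma edge_path_T_snoc:
  assumes "reach a" "(a, b) \<in> parcs H"
  shows "edge_path (T a @ [pt (a, b)])"
proof -
  obtain d where "(a, d) \<in> parcs H" "last (T a) = pt (a, d)" "edge_path (T a)"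
    using tail_path_T[OF assms(1)] by (auto simp: tail_path_def)
  then show ?thesis
    using bounded_in_pt_fst[of a d b b] assms T_nonempty by (simp add: edge_path_append pt_in)
qed

lemma reach_step:
  assumes "reach a" "(a, b) \<in> parcs H" "(c, b) \<in> parcs H"
  shows "reach c"
proof -
  have "edge_path ((T a @ [pt (a, b)]) @ [pt (c, b)])"
    using edge_path_T_snoc[OF assms(1,2)] bounded_in_pt_snd[of a b c c] assms
    by (subst edge_path_append) (auto simp: pt_in)
  then have "tail_path c ((T a @ [pt (a, b)]) @ [pt (c, b)])"
    using assms tail_path_T[OF assms(1)] T_nonempty[OF assms(1)] by (auto simp: tail_path_def)
  then show ?thesis by (auto simp: reach_def)
qed

definition nb :: "'a \<Rightarrow> 'a" where
  "nb b = (SOME a. (a, b) \<in> parcs H)"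

lemma nb: "(a, b) \<in> parcs H \<Longrightarrow> (nb b, b) \<in> parcs H"
  unfolding nb_def by (rule someI)

text \<open>
  The choice of \<open>nb b\<close> cancels in the product for \<open>(a, b) (c, b)\<^sup>-\<^sup>1\<close>, which becomes the edge from
  \<open>(a, b)\<close> to \<open>(c, b)\<close> joined to the base point by \<open>T\<close>. Arcs outside the component of \<open>e0\<close> get the
  constant loop.
\<close>

definition arc_loop :: "'a \<times> 'a \<Rightarrow> ('a set \<times> 'a set) list" where
  "arc_loop e = (if reach (fst e)
    then T (fst e) @ [pt e, pt (nb (snd e), snd e)] @ rev (T (nb (snd e))) else [pt e0])"

lemma arc_loop:
  assumes "(a, b) \<in> parcs H"
  shows "edge_path (arc_loop (a, b)) \<and> hd (arc_loop (a, b)) = pt e0 \<and> last (arc_loop (a, b)) = pt e0"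
proof (cases "reach a")
  case True
  have r: "reach (nb b)" using reach_step[OF True assms nb[OF assms]] .
  have "edge_path ((T a @ [pt (a, b)]) @ rev (T (nb b) @ [pt (nb b, b)]))"
    using edge_path_T_snoc[OF True assms] edge_path_T_snoc[OF r nb[OF assms]]
      bounded_in_pt_snd[of a b "nb b" "nb b"] assms nb[OF assms]
    by (subst edge_path_append) (auto simp only: edge_path_rev; simp)+
  then show ?thesis
    using True tail_path_T[OF True] tail_path_T[OF r] T_nonempty[OF True] T_nonempty[OF r]
    by (auto simp: arc_loop_def tail_path_def last_rev)
next
  case False
  then show ?thesis using e0 pt_in by (simp add: arc_loop_def)
qed

section \<open>Loops of words\<close>

definition letter_loop :: "bool \<times> 'a \<times> 'a \<Rightarrow> ('a set \<times> 'a set) list" where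
  "letter_loop x = (if fst x then rev (arc_loop (snd x)) else arc_loop (snd x))"

lemma letter_loop:
  assumes "snd x \<in> parcs H"
  shows "edge_path (letter_loop x)" "hd (letter_loop x) = pt e0" "last (letter_loop x) = pt e0"
    "letter_loop x \<noteq> []"
proof -
  have "edge_path (arc_loop (snd x)) \<and> hd (arc_loop (snd x)) = pt e0 \<and> last (arc_loop (snd x)) = pt e0"
    using arc_loop[of "fst (snd x)" "snd (snd x)"] assms by simp
  moreover from this have "arc_loop (snd x) \<noteq> []" by (auto simp: edge_path_def)
  ultimately show "edge_path (letter_loop x)" "hd (letter_loop x) = pt e0"
    "last (letter_loop x) = pt e0" "letter_loop x \<noteq> []"
    by (auto simp: letter_loop_def edge_path_rev hd_rev last_rev)
qed

lemma letter_loop_inv: "letter_loop (inv_letter x) = rev (letter_loop x)"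
  by (simp add: letter_loop_def inv_letter_def)

text \<open>The leading base point keeps the list nonempty for the empty word; otherwise it is a
  mere stutter.\<close>

definition word_loop :: "('a \<times> 'a) word \<Rightarrow> ('a set \<times> 'a set) list" where
  "word_loop w = pt e0 # concat (map letter_loop w)"

abbreviation is_word :: "('a \<times> 'a) word \<Rightarrow> bool" where
  "is_word w \<equiv> set w \<subseteq> UNIV \<times> parcs H"

lemma word_loop_Nil [simp]: "word_loop [] = [pt e0]"
  by (simp add: word_loop_def)

lemma word_loop_Cons:
  assumes "snd x \<in> parcs H"
  shows "word_loop (x # w) \<asymp> letter_loop x @ word_loop w"
proof -
  have "word_loop (x # w) \<asymp> letter_loop x @ concat (map letter_loop w)"
    using eqv_stutter_Cons[of "letter_loop x @ concat (map letter_loop w)" "pt e0" "[]"] letter_loop[OF assms]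
    by (simp add: word_loop_def)
  also have "\<dots> \<asymp> letter_loop x @ word_loop w"
    unfolding word_loop_def using letter_loop[OF assms] by (intro eqv_sym[OF eqv_stutter_snoc])
  finally show ?thesis .
qed

lemma word_loop_append:
  "is_word u \<Longrightarrow> word_loop (u @ v) \<asymp> word_loop u @ word_loop v"
proof (induction u)
  case Nil
  then show ?case using eqv_sym[OF eqv_stutter_Cons[of "word_loop v" "pt e0" "[]"]] by (simp add: word_loop_def)
next
  case (Cons x u)
  then have x: "snd x \<in> parcs H" by auto
  have "word_loop ((x # u) @ v) \<asymp> letter_loop x @ word_loop (u @ v)"
    using word_loop_Cons[OF x] by simp
  also have "\<dots> \<asymp> letter_loop x @ word_loop u @ word_loop v"
    using Cons by (intro eqv_append) auto
  also have "\<dots> \<asymp> word_loop (x # u) @ word_loop v"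
    using eqv_append[OF eqv_sym[OF word_loop_Cons[OF x, of u]], of "word_loop v" "word_loop v"] by simp
  finally show ?case .
qed

lemma word_loop_free_push:
  assumes "snd x \<in> parcs H"
  shows "word_loop (free_push x w) \<asymp> word_loop (x # w)"
proof (cases "\<exists>v. w = inv_letter x # v")
  case True
  then obtain v where w: "w = inv_letter x # v" by blast
  have "[pt e0] @ (letter_loop x @ rev (letter_loop x)) @ concat (map letter_loop v)
      \<asymp> [pt e0] @ [pt e0] @ concat (map letter_loop v)"
    using eqv_cancel[OF letter_loop(1)[OF assms]] letter_loop[OF assms] by (intro eqv_context) simp
  also have "\<dots> \<asymp> word_loop v"
    using eqv_stutter[of "[]" "pt e0" "concat (map letter_loop v)"] by (simp add: word_loop_def)
  finally show ?thesis
    unfolding w using eqv_sym by (simp add: word_loop_def letter_loop_inv)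
next
  case False
  then have "free_push x w = x # w" by (cases w) auto
  then show ?thesis by simp
qed

lemma word_loop_free_mult:
  assumes "is_word u"
  shows "word_loop (free_mult u v) \<asymp> word_loop u @ word_loop v"
  using assms
proof (induction u)
  case Nil
  then show ?case using word_loop_append[of "[]" v] by (simp add: free_mult_def)
next
  case (Cons x u)
  then have x: "snd x \<in> parcs H" by auto
  have "word_loop (free_mult (x # u) v) \<asymp> word_loop (x # free_mult u v)"
    using word_loop_free_push[OF x] by (simp add: free_mult_def)
  also have "\<dots> \<asymp> letter_loop x @ word_loop (free_mult u v)"
    by (rule word_loop_Cons[OF x])
  also have "\<dots> \<asymp> letter_loop x @ word_loop u @ word_loop v"
    using Cons by (intro eqv_append) auto
  also have "\<dots> \<asymp> word_loop (x # u) @ word_loop v"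
    using eqv_append[OF eqv_sym[OF word_loop_Cons[OF x, of u]], of "word_loop v" "word_loop v"] by simp
  finally show ?case .
qed

lemma word_loop_mult:
  assumes "u \<in> carrier F" "v \<in> carrier F"
  shows "word_loop (u \<otimes>\<^bsub>F\<^esub> v) \<asymp> word_loop u @ word_loop v"
  using word_loop_free_mult[of u v] assms by (simp add: free_group_def)

text \<open>The kernel of the homomorphism from the free group to the edge-path group at
  \<open>pt e0\<close> that \<open>word_loop\<close> induces; working with the kernel avoids forming
  this group.\<close>

definition null_words :: "('a \<times> 'a) word set" where
  "null_words = {w \<in> carrier F. word_loop w \<asymp> [pt e0]}"

lemma one_F: "\<one>\<^bsub>F\<^esub> = []"
  by (simp add: free_group_def)

lemma eqv_pt_e0: "[pt e0] @ word_loop w \<asymp> word_loop w" "word_loop w @ [pt e0] \<asymp> word_loop w" if "w \<in> carrier F"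
proof -
  show "[pt e0] @ word_loop w \<asymp> word_loop w"
    using eqv_stutter_Cons[of "word_loop w" "pt e0" "[]"] by (simp add: word_loop_def)
  have "word_loop (w \<otimes>\<^bsub>F\<^esub> \<one>\<^bsub>F\<^esub>) \<asymp> word_loop w @ word_loop \<one>\<^bsub>F\<^esub>"
    using that by (intro word_loop_mult) auto
  then show "word_loop w @ [pt e0] \<asymp> word_loop w"
    using that eqv_sym F.r_one[OF that] by (simp add: one_F)
qed

lemma null_words_normal: "null_words \<lhd> F"
proof -
  have sub: "subgroup null_words F"
  proof (rule F.subgroupI)
    show "null_words \<subseteq> carrier F" by (auto simp: null_words_def)
    show "null_words \<noteq> {}"
      using F.one_closed by (auto simp: null_words_def one_F)
    fix u assume u: "u \<in> null_words"
    then have uc: "u \<in> carrier F" and un: "word_loop u \<asymp> [pt e0]" by (auto simp: null_words_def)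
    have "word_loop (inv\<^bsub>F\<^esub> u) \<asymp> word_loop (inv\<^bsub>F\<^esub> u) @ [pt e0]"
      using uc by (intro eqv_sym[OF eqv_pt_e0(2)]) auto
    also have "\<dots> \<asymp> word_loop (inv\<^bsub>F\<^esub> u) @ word_loop u"
      using un by (intro eqv_append) (auto intro: eqv_sym)
    also have "\<dots> \<asymp> word_loop (inv\<^bsub>F\<^esub> u \<otimes>\<^bsub>F\<^esub> u)"
      using uc by (intro eqv_sym[OF word_loop_mult]) auto
    also have "word_loop (inv\<^bsub>F\<^esub> u \<otimes>\<^bsub>F\<^esub> u) = [pt e0]"
      using uc by (simp add: one_F)
    finally show "inv\<^bsub>F\<^esub> u \<in> null_words" using uc by (simp add: null_words_def)
    fix v assume v: "v \<in> null_words"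
    then have vc: "v \<in> carrier F" and vn: "word_loop v \<asymp> [pt e0]" by (auto simp: null_words_def)
    have "word_loop (u \<otimes>\<^bsub>F\<^esub> v) \<asymp> word_loop u @ word_loop v"
      using uc vc by (rule word_loop_mult)
    also have "\<dots> \<asymp> word_loop u @ [pt e0]" using vn by (intro eqv_append) auto
    also have "\<dots> \<asymp> word_loop u" using uc by (rule eqv_pt_e0)
    also have "\<dots> \<asymp> [pt e0]" by (rule un)
    finally show "u \<otimes>\<^bsub>F\<^esub> v \<in> null_words" using uc vc by (simp add: null_words_def)
  qed
  moreover have "x \<otimes>\<^bsub>F\<^esub> h \<otimes>\<^bsub>F\<^esub> inv\<^bsub>F\<^esub> x \<in> null_words" if x: "x \<in> carrier F" and h: "h \<in> null_words" for x h
  proof -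
    have hc: "h \<in> carrier F" and hn: "word_loop h \<asymp> [pt e0]" using h by (auto simp: null_words_def)
    have "word_loop (x \<otimes>\<^bsub>F\<^esub> h) \<asymp> word_loop x @ word_loop h"
      using x hc by (rule word_loop_mult)
    also have "\<dots> \<asymp> word_loop x @ [pt e0]" using hn by (intro eqv_append) auto
    also have "\<dots> \<asymp> word_loop x" using x by (rule eqv_pt_e0)
    finally have xh: "word_loop (x \<otimes>\<^bsub>F\<^esub> h) \<asymp> word_loop x" .
    have "word_loop (x \<otimes>\<^bsub>F\<^esub> h \<otimes>\<^bsub>F\<^esub> inv\<^bsub>F\<^esub> x) \<asymp> word_loop (x \<otimes>\<^bsub>F\<^esub> h) @ word_loop (inv\<^bsub>F\<^esub> x)"
      using x hc by (intro word_loop_mult) auto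
    also have "\<dots> \<asymp> word_loop x @ word_loop (inv\<^bsub>F\<^esub> x)"
      using xh by (intro eqv_append) auto
    also have "\<dots> \<asymp> word_loop (x \<otimes>\<^bsub>F\<^esub> inv\<^bsub>F\<^esub> x)"
      using x by (intro eqv_sym[OF word_loop_mult]) auto
    also have "word_loop (x \<otimes>\<^bsub>F\<^esub> inv\<^bsub>F\<^esub> x) = [pt e0]"
      using x by (simp add: one_F)
    finally show ?thesis using x hc by (simp add: null_words_def)
  qed
  ultimately show ?thesis by (simp add: F.normal_inv_iff)
qed

lemma inv_free_gen: "e \<in> parcs H \<Longrightarrow> inv\<^bsub>F\<^esub> free_gen e = [(True, e)]"
  by (rule F.inv_equality)
    (auto simp: free_group_def free_mult_def free_gen_def inv_letter_def reduced_word_Cons)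

text \<open>If \<open>reach a\<close> holds, both loops pass through \<open>(nb b, b)\<close> and
  the path \<open>T (nb b)\<close>. The two traversals of this path are inverse and cancel, and the
  arcs left over share the tail \<open>nb b\<close> or the head \<open>b\<close>, so triangles
  remove them. Otherwise both arcs have the constant loop.\<close>

lemma word_loop_pair:
  assumes "(a, b) \<in> parcs H" "(c, b) \<in> parcs H"
  shows "word_loop (free_gen (a, b) \<otimes>\<^bsub>F\<^esub> inv\<^bsub>F\<^esub> free_gen (c, b))
    \<asymp> (if reach a then T a @ [pt (a, b), pt (c, b)] @ rev (T c) else [pt e0])"
proof -
  have "word_loop (free_gen (a, b) \<otimes>\<^bsub>F\<^esub> inv\<^bsub>F\<^esub> free_gen (c, b))
      \<asymp> word_loop (free_gen (a, b)) @ word_loop (inv\<^bsub>F\<^esub> free_gen (c, b))"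
    using assms by (intro word_loop_mult) (auto intro: free_gen_in_carrier)
  also have "\<dots> = pt e0 # arc_loop (a, b) @ pt e0 # rev (arc_loop (c, b))"
    using assms by (simp add: inv_free_gen word_loop_def letter_loop_def) (simp add: free_gen_def letter_loop_def)
  also have "\<dots> \<asymp> arc_loop (a, b) @ pt e0 # rev (arc_loop (c, b))"
    using letter_loop[of "(False, a, b)"] assms
      eqv_stutter_Cons[of "arc_loop (a, b) @ pt e0 # rev (arc_loop (c, b))" "pt e0" "[]"]
    by (simp add: letter_loop_def)
  also have "\<dots> \<asymp> arc_loop (a, b) @ rev (arc_loop (c, b))"
    using letter_loop[of "(True, c, b)"] assms
    by (intro eqv_stutter_Cons) (auto simp: letter_loop_def)
  also have "\<dots> \<asymp> (if reach a then T a @ [pt (a, b), pt (c, b)] @ rev (T c) else [pt e0])"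
  proof (cases "reach a")
    case True
    have c: "reach c" using reach_step[OF True assms] .
    define s where "s = nb b"
    have s: "(s, b) \<in> parcs H" "reach s"
      unfolding s_def using nb[OF assms(1)] reach_step[OF True assms(1) nb[OF assms(1)]] by auto
    have st: "edge_path (T s)" using tail_path_T[OF s(2)] by (simp add: tail_path_def)
    obtain d where d: "(s, d) \<in> parcs H" "last (T s) = pt (s, d)"
      using tail_path_T[OF s(2)] by (auto simp: tail_path_def)
    have "arc_loop (a, b) @ rev (arc_loop (c, b))
      = (T a @ [pt (a, b), pt (s, b)]) @ (rev (T s) @ T s) @ ([pt (s, b), pt (c, b)] @ rev (T c))"
      using True c by (simp add: arc_loop_def s_def)
    also have "\<dots> \<asymp> (T a @ [pt (a, b), pt (s, b)]) @ [pt (s, d)] @ ([pt (s, b), pt (c, b)] @ rev (T c))"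
      using eqv_cancel'[OF st] d by (intro eqv_context) simp
    also have "\<dots> = (T a @ [pt (a, b)]) @ pt (s, b) # pt (s, d) # pt (s, b) # (pt (c, b) # rev (T c))"
      by simp
    also have "\<dots> \<asymp> (T a @ [pt (a, b)]) @ pt (s, b) # pt (s, b) # (pt (c, b) # rev (T c))"
      using bounded_in_pt_fst[OF s(1) d(1) s(1)] by (rule eqv_triangle)
    also have "\<dots> \<asymp> (T a @ [pt (a, b)]) @ pt (s, b) # (pt (c, b) # rev (T c))"
      by (rule eqv_stutter)
    also have "\<dots> = T a @ pt (a, b) # pt (s, b) # pt (c, b) # rev (T c)" by simp
    also have "\<dots> \<asymp> T a @ pt (a, b) # pt (c, b) # rev (T c)"
      using bounded_in_pt_snd[OF assms(1) s(1) assms(2)] by (rule eqv_triangle)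
    finally show ?thesis using True by simp
  next
    case False
    then have "\<not> reach c" using reach_step[of c b a] assms by blast
    then show ?thesis using False eqv_stutter[of "[]" "pt e0" "[]"] by (simp add: arc_loop_def)
  qed
  finally show ?thesis .
qed

text \<open>The relator is a product of two pairs. Once the passage through \<open>T c\<close> has
  cancelled, its loop runs along \<open>T a\<close>, around the square of the 4-cycle, and back
  along \<open>T a\<close>. The square is filled by the two triangles of
  \<open>bounded_in_pt_pair\<close>.\<close>

lemma relators_null: "four_cycle_relators H \<subseteq> null_words"
proof
  fix r assume "r \<in> four_cycle_relators H"
  then obtain a b c d where arcs: "(a, b) \<in> parcs H" "(c, b) \<in> parcs H" "(c, d) \<in> parcs H" "(a, d) \<in> parcs H"
    and r: "r = free_gen (a, b) \<otimes>\<^bsub>F\<^esub> inv\<^bsub>F\<^esub> free_gen (c, b) \<otimes>\<^bsub>F\<^esub> free_gen (c, d) \<otimes>\<^bsub>F\<^esub> inv\<^bsub>F\<^esub> free_gen (a, d)"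
    unfolding four_cycle_relators_def using arc_sym by blast
  have gens: "free_gen (a, b) \<in> carrier F" "free_gen (c, b) \<in> carrier F"
    "free_gen (c, d) \<in> carrier F" "free_gen (a, d) \<in> carrier F"
    using arcs by (auto intro: free_gen_in_carrier)
  let ?u = "free_gen (a, b) \<otimes>\<^bsub>F\<^esub> inv\<^bsub>F\<^esub> free_gen (c, b)"
  let ?v = "free_gen (c, d) \<otimes>\<^bsub>F\<^esub> inv\<^bsub>F\<^esub> free_gen (a, d)"
  have r': "r = ?u \<otimes>\<^bsub>F\<^esub> ?v" using gens by (simp add: r F.m_assoc)
  have rc: "r \<in> carrier F" using gens by (simp add: r)
  have "word_loop r \<asymp> word_loop ?u @ word_loop ?v"
    unfolding r' using gens by (intro word_loop_mult) auto
  also have "\<dots> \<asymp> [pt e0]"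
  proof (cases "reach a")
    case True
    have c: "reach c" using reach_step[OF True arcs(1,2)] .
    obtain x where x: "(c, x) \<in> parcs H" "last (T c) = pt (c, x)" "edge_path (T c)"
      using tail_path_T[OF c] by (auto simp: tail_path_def)
    obtain y where y: "(a, y) \<in> parcs H" "last (T a) = pt (a, y)" "edge_path (T a)" "hd (T a) = pt e0"
      using tail_path_T[OF True] by (auto simp: tail_path_def)
    have "word_loop ?u @ word_loop ?v
        \<asymp> (T a @ [pt (a, b), pt (c, b)] @ rev (T c)) @ (T c @ [pt (c, d), pt (a, d)] @ rev (T a))"
      using word_loop_pair[OF arcs(1,2)] word_loop_pair[OF arcs(3,4)] True c by (intro eqv_append) auto
    also have "\<dots> = (T a @ [pt (a, b), pt (c, b)]) @ (rev (T c) @ T c) @ ([pt (c, d), pt (a, d)] @ rev (T a))"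
      by simp
    also have "\<dots> \<asymp> (T a @ [pt (a, b), pt (c, b)]) @ [pt (c, x)] @ ([pt (c, d), pt (a, d)] @ rev (T a))"
      using eqv_cancel'[OF x(3)] x(2) by (intro eqv_context) simp
    also have "\<dots> = (T a @ [pt (a, b)]) @ pt (c, b) # pt (c, x) # pt (c, d) # (pt (a, d) # rev (T a))"
      by simp
    also have "\<dots> \<asymp> (T a @ [pt (a, b)]) @ pt (c, b) # pt (c, d) # (pt (a, d) # rev (T a))"
      using bounded_in_pt_fst[OF arcs(2) x(1) arcs(3)] by (rule eqv_triangle)
    also have "\<dots> = T a @ pt (a, b) # pt (c, b) # pt (c, d) # (pt (a, d) # rev (T a))" by simp
    also have "\<dots> \<asymp> T a @ pt (a, b) # pt (c, d) # (pt (a, d) # rev (T a))"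
      using bounded_in_pt_pair(1)[OF arcs(1,4,2,3)] by (rule eqv_triangle)
    also have "\<dots> \<asymp> T a @ pt (a, b) # pt (a, d) # rev (T a)"
      using bounded_in_pt_pair(2)[OF arcs(1,4,2,3)] by (rule eqv_triangle)
    \<comment> \<open>The remaining arcs have tail \<open>a\<close>, like the last arc of
      \<open>T a\<close>, so they are absorbed into it.\<close>
    also have "\<dots> \<asymp> T a @ pt (a, d) # rev (T a)"
      using bounded_in_pt_fst[OF y(1) arcs(1,4)] y T_nonempty[OF True] by (intro eqv_triangle') auto
    also have "\<dots> \<asymp> T a @ rev (T a)"
      using bounded_in_pt_fst[OF y(1) arcs(4) y(1)] y T_nonempty[OF True]
      by (intro eqv_triangle') (auto simp: hd_rev)
    also have "\<dots> \<asymp> [pt e0]"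
      using eqv_cancel[OF y(3)] y(4) by simp
    finally show ?thesis .
  next
    case False
    then have c: "\<not> reach c" using reach_step[of c b a] arcs by blast
    have "word_loop ?u @ word_loop ?v \<asymp> [pt e0] @ [pt e0]"
      using word_loop_pair[OF arcs(1,2)] word_loop_pair[OF arcs(3,4)] False c by (intro eqv_append) auto
    also have "\<dots> \<asymp> [pt e0]" using eqv_stutter[of "[]" "pt e0" "[]"] by simp
    finally show ?thesis .
  qed
  finally show "r \<in> null_words" using rc by (simp add: null_words_def)
qed

lemma arc_normal_null: "arc_normal H \<subseteq> null_words"
  unfolding arc_normal_def normal_closure_def using null_words_normal relators_null by blast

end

section \<open>The loop of an odd cycle with trivial signature\<close>

context arc_graph begin

lemma proj_lprod:
  "set xs \<subseteq> carrier F \<Longrightarrow> proj (F.lprod xs) = G.lprod (map proj xs)"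
  by (induction xs) (auto simp: proj.hom_mult)

text \<open>The signature lifts to a word whose loop is, up to homotopy,
  \<open>q 0, ..., q (2 * n)\<close>. Triviality makes this loop null-homotopic, and its second half
  is the swapped first half; moving it to the other side gives the claim.\<close>

lemma null_loop_of_signature_one:
  assumes n: "odd n" and hom: "graph_hom f (cycle_graph n) H"
    and sig: "signature H n f = \<one>\<^bsub>G\<^esub>"
  obtains q where "edge_path (map q [0..<Suc n])" "\<And>k. q (k + n) = prod.swap (q k)"
    "map q [0..<Suc n] \<asymp> rev (map prod.swap (map q [0..<Suc n]))"
proof -
  define v where "v k = f (k mod n)" for k
  define arc where "arc k = (if even k then (v k, v (Suc k)) else (v (Suc k), v k))" for k
  define q where "q k = pt (arc k)" for k
  have n0: "n > 0" using n by (cases n) auto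
  have adj: "(v k, v (Suc k)) \<in> parcs H" for k
  proof -
    have "(k mod n, Suc k mod n) \<in> parcs (cycle_graph n)"
      using n0 by (simp add: cycle_graph_def mod_Suc_eq)
    then show ?thesis using hom by (auto simp: graph_hom_def v_def)
  qed
  have adj': "(v (Suc k), v k) \<in> parcs H" for k using adj arc_sym by blast
  have vn: "v (k + n) = v k" for k by (simp add: v_def)
  have arc_in: "arc k \<in> parcs H" for k using adj adj' by (simp add: arc_def)
  have qP: "q k \<in> hom_K2 H" for k unfolding q_def by (rule pt_in[OF arc_in])
  have arc_even: "arc (2 * i) = (v (2 * i), v (Suc (2 * i)))"
    and arc_odd: "arc (Suc (2 * i)) = (v (Suc (Suc (2 * i))), v (Suc (2 * i)))" for i
    by (auto simp: arc_def)
  \<comment> \<open>As \<open>n\<close> is odd, the shift by \<open>n\<close> changes the parity of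
    \<open>k\<close> and thus reverses the orientation of the same edge.\<close>
  have q_swap: "q (k + n) = prod.swap (q k)" for k
    using vn[of k] vn[of "Suc k"] n by (auto simp: q_def arc_def pt_def)
  have q_step: "bounded_in {q k, q (Suc k)}" for k
  proof (cases "even k")
    case True
    then show ?thesis
      using bounded_in_pt_snd[OF adj[of k] adj'[of "Suc k"] adj'[of "Suc k"]] by (simp add: q_def arc_def)
  next
    case False
    then show ?thesis
      using bounded_in_pt_fst[OF adj'[of k] adj[of "Suc k"] adj[of "Suc k"]] by (simp add: q_def arc_def)
  qed
  have q_path: "edge_path (map q [i..<j])" if "i < j" for i j
    using that
  proof (induction j)
    case (Suc j)
    show ?case
    proof (cases "i < j")
      case True
      then obtain j' where j': "j = Suc j'" "i \<le> j'" by (cases j) auto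
      then have "last (map q [i..<j]) = q j'" "bounded_in {q j', q j}" using q_step by auto
      then have "edge_path (map q [i..<j] @ [q j])"
        using Suc.IH True qP by (subst edge_path_append) auto
      then show ?thesis using True by simp
    next
      case False
      then have "i = j" using Suc.prems by simp
      then show ?thesis using qP by simp
    qed
  qed simp
  interpret based_arc_graph H "arc 0"
    by unfold_locales (rule arc_in)
  have pt_e0: "pt (arc 0) = q 0" by (simp add: q_def)
  have fst0: "fst (arc 0) = v 0" by (simp add: arc_def)
  have T0: "T (v 0) = [q 0]" by (simp add: T_def fst0 pt_e0)
  have reach_v: "reach (v (2 * i))" for i
  proof (induction i)
    case 0
    then show ?case using reach_e0 fst0 by simp
  next
    case (Suc i)
    then show ?case using reach_step[OF Suc adj adj'] by simp
  qed
  define t where "t i = free_gen (arc (2 * i)) \<otimes>\<^bsub>F\<^esub> inv\<^bsub>F\<^esub> free_gen (arc (Suc (2 * i)))" for i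
  have tc: "t i \<in> carrier F" for i
    unfolding t_def using arc_in by (auto intro: free_gen_in_carrier)
  define w where "w m = F.lprod (map t [0..<m])" for m
  have wc: "w m \<in> carrier F" for m unfolding w_def using tc by (intro F.lprod_closed) auto
  have wS: "w (Suc m) = w m \<otimes>\<^bsub>F\<^esub> t m" for m
    using tc unfolding w_def by (simp add: F.lprod_append image_subset_iff)
  have proj_t: "proj (t i) = cls (arc (2 * i)) \<otimes>\<^bsub>G\<^esub> inv\<^bsub>G\<^esub> cls (arc (Suc (2 * i)))" for i
    unfolding t_def cls_eq_proj using arc_in by (simp add: proj.hom_mult free_gen_in_carrier)
  have "proj (w n) = G.lprod (map (proj \<circ> t) [0..<n])"
    unfolding w_def using tc by (subst proj_lprod) (auto simp: image_subset_iff)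
  also have "\<dots> = signature H n f"
    unfolding signature_eq_lprod
    by (intro arg_cong[of _ _ G.lprod] map_cong) (simp_all add: proj_t arc_even arc_odd v_def)
  finally have "w n \<in> arc_normal H"
    using sig proj_eq_one_iff[OF wc] by simp
  then have null: "word_loop (w n) \<asymp> [q 0]"
    using arc_normal_null by (auto simp: null_words_def pt_e0)
  \<comment> \<open>The first \<open>m\<close> factors trace \<open>q\<close> over the indices below
    \<open>2 * m\<close>; the path \<open>T\<close> then returns to the base point. The next factor
    starts along the same \<open>T\<close>, so the return cancels.\<close>
  have loop: "word_loop (w m) \<asymp> (q 0 # map q [0..<2 * m]) @ rev (T (v (2 * m)))" for m
  proof (induction m)
    case 0
    show ?case using eqv_sym[OF eqv_stutter[of "[]" "q 0" "[]"]] by (simp add: w_def one_F T0 pt_e0)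
  next
    case (Suc m)
    let ?c = "v (2 * m)" and ?c' = "v (2 * Suc m)" and ?u = "q 0 # map q [0..<2 * m]"
    obtain x where x: "(?c, x) \<in> parcs H" "last (T ?c) = pt (?c, x)" "edge_path (T ?c)"
      using tail_path_T[OF reach_v] unfolding tail_path_def by blast
    \<comment> \<open>For \<open>m = 0\<close> the last element is the extra \<open>q 0\<close> in
      front, otherwise it is \<open>q (2 * m - 1)\<close>; in both cases it is an arc with tail
      \<open>?c\<close>.\<close>
    obtain b where b: "(?c, b) \<in> parcs H" "last ?u = pt (?c, b)"
    proof (cases m)
      case 0
      then have "last ?u = pt (?c, v 1)" "(?c, v 1) \<in> parcs H"
        using adj[of 0] by (auto simp: q_def arc_def)
      then show ?thesis using that by blast
    next
      case (Suc k)
      have "last ?u = q (Suc (2 * k))" by (simp add: Suc)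
      also have "\<dots> = pt (?c, v (Suc (2 * k)))" by (simp add: q_def arc_odd Suc)
      finally show ?thesis using that adj'[of "Suc (2 * k)"] by (simp add: Suc)
    qed
    have qm: "q (2 * m) = pt (?c, v (Suc (2 * m)))" by (simp add: q_def arc_even)
    have qm': "q (Suc (2 * m)) = pt (?c', v (Suc (2 * m)))" by (simp add: q_def arc_odd)
    have "word_loop (w (Suc m)) \<asymp> word_loop (w m) @ word_loop (t m)"
      unfolding wS using wc tc by (rule word_loop_mult)
    also have "\<dots> \<asymp> (?u @ rev (T ?c)) @ (T ?c @ [q (2 * m), q (Suc (2 * m))] @ rev (T ?c'))"
    proof (rule eqv_append)
      show "word_loop (t m) \<asymp> T ?c @ [q (2 * m), q (Suc (2 * m))] @ rev (T ?c')"
        unfolding t_def arc_even arc_odd qm qm'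
        using word_loop_pair[OF adj[of "2 * m"] adj'[of "Suc (2 * m)"]] reach_v[of m] by simp
    qed (rule Suc.IH)
    also have "\<dots> = ?u @ (rev (T ?c) @ T ?c) @ ([q (2 * m), q (Suc (2 * m))] @ rev (T ?c'))"
      by simp
    also have "\<dots> \<asymp> ?u @ [pt (?c, x)] @ ([q (2 * m), q (Suc (2 * m))] @ rev (T ?c'))"
      using eqv_cancel'[OF x(3)] x(2) by (intro eqv_context) simp
    also have "\<dots> = ?u @ pt (?c, x) # ([q (2 * m), q (Suc (2 * m))] @ rev (T ?c'))"
      by simp
    also have "\<dots> \<asymp> ?u @ ([q (2 * m), q (Suc (2 * m))] @ rev (T ?c'))"
      using bounded_in_pt_fst[OF b(1) x(1) adj[of "2 * m"]] b(2) by (intro eqv_triangle') (simp_all add: qm)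
    finally show ?case by simp
  qed
  have q2n: "q (2 * n) = q 0"
    using q_swap[of n] q_swap[of 0] by (simp add: mult_2)
  have v2n: "v (2 * n) = v 0" by (simp add: v_def)
  define xs where "xs = map q [0..<Suc n]"
  define ys where "ys = map q [n..<Suc (2 * n)]"
  have ys: "ys = map prod.swap xs"
    unfolding xs_def ys_def by (rule nth_equalityI) (auto simp: q_swap add.commute[of n] simp del: upt_Suc)
  have ys_path: "edge_path ys" unfolding ys_def by (rule q_path) simp
  have ends: "last xs = q n" "hd ys = q n" "last ys = q 0" "xs \<noteq> []" "ys \<noteq> []"
    using q2n by (auto simp: xs_def ys_def hd_map simp del: upt_Suc) (simp_all add: last_map)
  \<comment> \<open>\<open>q n\<close> ends the first half and starts the second, so it occurs twice
    in \<open>xs @ ys\<close>.\<close>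
  have "xs @ ys = map q [0..<n] @ q n # ys"
    by (simp add: xs_def)
  also have "\<dots> \<asymp> map q [0..<n] @ ys"
    using ends by (intro eqv_stutter_Cons) auto
  also have "map q [0..<n] @ ys = map q [0..<2 * n] @ [q 0]"
  proof -
    have "[0..<2 * n] = [0..<n] @ [n..<2 * n]" using upt_add_eq_append[of 0 n n] by (simp add: mult_2)
    then show ?thesis by (simp add: ys_def q2n)
  qed
  also have "\<dots> \<asymp> q 0 # map q [0..<2 * n] @ [q 0]"
    using eqv_sym[OF eqv_stutter_Cons[of "map q [0..<2 * n] @ [q 0]" "q 0" "[]"]] n0
    by (auto simp: hd_append hd_map)
  also have "\<dots> = (q 0 # map q [0..<2 * n]) @ rev (T (v (2 * n)))"
    by (simp add: v2n T0)
  also have "\<dots> \<asymp> word_loop (w n)" by (rule eqv_sym[OF loop])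
  also have "\<dots> \<asymp> [q 0]" by (rule null)
  finally have xy: "xs @ ys \<asymp> [q 0]" .
  have "xs \<asymp> xs @ [q n]"
    using eqv_sym[OF eqv_stutter_snoc[of xs "q n" "[]"]] ends by simp
  also have "\<dots> \<asymp> xs @ (ys @ rev ys)"
    using eqv_cancel[OF ys_path] ends by (intro eqv_append) (auto intro: eqv_sym)
  also have "\<dots> = (xs @ ys) @ rev ys" by simp
  also have "\<dots> \<asymp> [q 0] @ rev ys" using xy by (intro eqv_append) auto
  also have "\<dots> \<asymp> rev ys"
    using eqv_stutter_Cons[of "rev ys" "q 0" "[]"] ends by (simp add: hd_rev)
  finally have "xs \<asymp> rev ys" .
  then show thesis
    using that[of q] q_path[of 0 "Suc n"] q_swap by (simp add: ys xs_def del: upt_Suc)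
qed

section \<open>Realising edge paths\<close>

definition vtx :: "'a set \<times> 'a set \<Rightarrow> 'a set \<times> 'a set \<Rightarrow> real" where
  "vtx p r = (if r = p then 1 else 0)"

definition mix :: "real \<Rightarrow> ('a set \<times> 'a set \<Rightarrow> real) \<Rightarrow> ('a set \<times> 'a set \<Rightarrow> real) \<Rightarrow> 'a set \<times> 'a set \<Rightarrow> real" where
  "mix s t t' r = (1 - s) * t r + s * t' r"

text \<open>The realization of the order complex of the elements below \<open>q\<close>; for
  \<open>q\<close> in the poset it is a cone with apex \<open>vtx q\<close>.\<close>

definition lower_cone :: "'a set \<times> 'a set \<Rightarrow> ('a set \<times> 'a set \<Rightarrow> real) set" where
  "lower_cone q = {t \<in> X. \<forall>p. t p \<noteq> 0 \<longrightarrow> p \<le> q}"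

text \<open>The chain \<open>K\<close> may be larger than the support, which suits convex
  combinations: their support can shrink at the ends of the segment.\<close>

lemma X_I:
  assumes "\<And>p. 0 \<le> t p" "finite K" "K \<subseteq> hom_K2 H" "Complete_Partial_Order.chain (\<le>) K"
    "\<And>p. p \<notin> K \<Longrightarrow> t p = 0" "sum t K = 1"
  shows "t \<in> X"
proof -
  let ?S = "{p. t p \<noteq> 0}"
  have sub: "?S \<subseteq> K" using assms(5) by blast
  have sum1: "sum t ?S = 1"
    using assms(2,6) sub by (subst sum.mono_neutral_left[of K ?S]) auto
  then have "?S \<noteq> {}" by (metis sum.empty zero_neq_one)
  moreover have "Complete_Partial_Order.chain (\<le>) ?S"
    using assms(4) sub by (rule chain_subset)
  moreover have "finite ?S" using sub assms(2) by (rule finite_subset)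
  moreover have "?S \<subseteq> hom_K2 H" using sub assms(3) by (rule subset_trans)
  ultimately have "?S \<in> order_complex (hom_K2 H)" by (simp add: order_complex_def)
  then show ?thesis using assms(1) sum1 by (simp add: X_def)
qed

lemma mix_in_cone:
  assumes "t \<in> lower_cone q" "q \<in> hom_K2 H" "s \<in> {0..1}"
  shows "mix s t (vtx q) \<in> lower_cone q"
proof -
  let ?K = "insert q {p. t p \<noteq> 0}"
  have t: "\<And>p. 0 \<le> t p" "finite {p. t p \<noteq> 0}" "{p. t p \<noteq> 0} \<subseteq> hom_K2 H"
    "Complete_Partial_Order.chain (\<le>) {p. t p \<noteq> 0}" "(\<Sum>p | t p \<noteq> 0. t p) = 1"
    "\<And>p. t p \<noteq> 0 \<Longrightarrow> p \<le> q"
    using assms(1) by (simp_all add: lower_cone_def X_def order_complex_def del: split_paired_All split_paired_Ex)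
  have "mix s t (vtx q) \<in> X"
  proof (rule X_I[of _ ?K])
    show "0 \<le> mix s t (vtx q) p" for p
      using t(1)[of p] assms(3) by (simp add: mix_def vtx_def)
    show "Complete_Partial_Order.chain (\<le>) ?K"
    proof (rule chainI)
      fix x y assume "x \<in> ?K" "y \<in> ?K"
      then show "x \<le> y \<or> y \<le> x"
        using chainD[OF t(4), of x y] t(6) by blast
    qed
    show "mix s t (vtx q) p = 0" if "p \<notin> ?K" for p
      using that by (simp add: mix_def vtx_def)
    have "sum t ?K = 1"
      using t(2,5) by (subst sum.mono_neutral_right[of ?K "{p. t p \<noteq> 0}"]) auto
    moreover have "sum (vtx q) ?K = 1"
      using t(2) by (simp add: vtx_def)
    moreover have "sum (mix s t (vtx q)) ?K = (1 - s) * sum t ?K + s * sum (vtx q) ?K"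
      unfolding sum_distrib_left sum.distrib[symmetric] by (rule sum.cong) (auto simp: mix_def)
    ultimately show "sum (mix s t (vtx q)) ?K = 1" by simp
  qed (use t(2,3) assms(2) in auto)
  moreover have "p \<le> q" if "mix s t (vtx q) p \<noteq> 0" for p
    using that t(6)[of p] by (cases "p = q") (auto simp: mix_def vtx_def)
  ultimately show ?thesis by (simp add: lower_cone_def)
qed

lemma vtx_in_cone: "p \<in> hom_K2 H \<Longrightarrow> p \<le> q \<Longrightarrow> vtx p \<in> lower_cone q"
  unfolding lower_cone_def
  by (auto intro!: X_I[of _ "{p}"] simp: vtx_def Complete_Partial_Order.chain_def split: if_splits)

lemma cone_mono: "p \<le> q \<Longrightarrow> lower_cone p \<subseteq> lower_cone q"
  unfolding lower_cone_def by (blast intro: order_trans)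

lemma homotopic_paths_cone:
  assumes "q \<in> hom_K2 H" "path g" "path_image g \<subseteq> lower_cone q" "path h" "path_image h \<subseteq> lower_cone q"
    "pathstart g = pathstart h" "pathfinish g = pathfinish h"
  shows "homotopic_paths X g h"
proof (rule homotopic_paths_subset)
  show "homotopic_paths (lower_cone q) g h"
  proof (rule homotopic_paths_contraction[where c = "\<lambda>y. mix (fst y) (snd y) (vtx q)" and a = "vtx q"])
    show "continuous_on ({0..1} \<times> lower_cone q) (\<lambda>y. mix (fst y) (snd y) (vtx q))"
    proof (rule continuous_on_coordinatewise_then_product)
      fix r
      have "continuous_on ({0..1} \<times> lower_cone q) (\<lambda>y :: real \<times> _. snd y r)"
        by (rule continuous_on_product_then_coordinatewise) (rule continuous_on_snd[OF continuous_on_id])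
      then show "continuous_on ({0..1} \<times> lower_cone q) (\<lambda>y. mix (fst y) (snd y) (vtx q) r)"
        unfolding mix_def by (intro continuous_intros)
    qed
    show "(\<lambda>y. mix (fst y) (snd y) (vtx q)) ` ({0..1} \<times> lower_cone q) \<subseteq> lower_cone q"
      using mix_in_cone[OF _ assms(1)] by auto
  qed (use assms in \<open>auto simp: mix_def\<close>)
  show "lower_cone q \<subseteq> X" by (auto simp: lower_cone_def)
qed

section \<open>Segments and the realization of edge paths\<close>

definition lseg :: "'a set \<times> 'a set \<Rightarrow> 'a set \<times> 'a set \<Rightarrow> real \<Rightarrow> 'a set \<times> 'a set \<Rightarrow> real" where
  "lseg p q u = mix u (vtx p) (vtx q)"

text \<open>Joined elements need not be comparable, so the straight line between their vertices may
  leave \<open>X\<close>; the detour over \<open>sup p q\<close> stays inside. The supremum, unlike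
  an arbitrary choice of upper bound, makes the segment compatible with reversal and with the
  swap.\<close>

definition seg :: "'a set \<times> 'a set \<Rightarrow> 'a set \<times> 'a set \<Rightarrow> real \<Rightarrow> 'a set \<times> 'a set \<Rightarrow> real" where
  "seg p q = lseg p (sup p q) +++ lseg (sup p q) q"

lemma lseg_ends [simp]: "pathstart (lseg p q) = vtx p" "pathfinish (lseg p q) = vtx q"
  by (auto simp: pathstart_def pathfinish_def lseg_def mix_def)

lemma reversepath_lseg: "reversepath (lseg p q) = lseg q p"
  by (auto simp: reversepath_def lseg_def mix_def fun_eq_iff)

lemma path_lseg: "path (lseg p q)"
  unfolding path_def lseg_def
proof (rule continuous_on_coordinatewise_then_product)
  show "continuous_on {0..1} (\<lambda>u. mix u (vtx p) (vtx q) r)" for r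
    unfolding mix_def by (intro continuous_intros)
qed

lemma path_image_lseg:
  assumes "p \<in> hom_K2 H" "q \<in> hom_K2 H" "p \<le> q"
  shows "path_image (lseg p q) \<subseteq> lower_cone q"
  unfolding path_image_def lseg_def using assms by (auto intro!: mix_in_cone vtx_in_cone)

lemma seg_ends [simp]: "pathstart (seg p q) = vtx p" "pathfinish (seg p q) = vtx q"
  by (auto simp: seg_def)

lemma path_seg: "path (seg p q)"
  by (simp add: seg_def path_lseg)

lemma reversepath_seg: "reversepath (seg p q) = seg q p"
  by (simp add: seg_def reversepath_joinpaths reversepath_lseg sup_commute)

lemma sup_in_hom_K2:
  assumes "p \<in> hom_K2 H" "q \<in> hom_K2 H" "p \<le> m" "q \<le> m" "m \<in> hom_K2 H"
  shows "sup p q \<in> hom_K2 H"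
proof -
  have "sup p q \<le> m" using assms by simp
  then have "fst (sup p q) \<subseteq> fst m" "snd (sup p q) \<subseteq> snd m" by (auto simp: less_eq_prod_def)
  moreover have "fst m \<times> snd m \<subseteq> parcs H" "fst m \<subseteq> pverts H" "snd m \<subseteq> pverts H"
    using assms(5) by (cases m; simp add: hom_K2_def)+
  moreover have "fst p \<noteq> {}" "snd p \<noteq> {}" using assms(1) by (cases p; simp add: hom_K2_def)+
  ultimately show ?thesis
    unfolding hom_K2_def by (cases p; cases q) (simp add: sup_prod_def, blast)
qed

lemma path_image_seg:
  assumes "p \<in> hom_K2 H" "q \<in> hom_K2 H" "p \<le> m" "q \<le> m" "m \<in> hom_K2 H"
  shows "path_image (seg p q) \<subseteq> lower_cone m"
proof -
  note s = sup_in_hom_K2[OF assms]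
  have "path_image (lseg p (sup p q)) \<subseteq> lower_cone (sup p q)"
    using assms s by (intro path_image_lseg) auto
  moreover have "path_image (lseg (sup p q) q) \<subseteq> lower_cone (sup p q)"
    using path_image_lseg[OF assms(2) s] path_image_reversepath[of "lseg q (sup p q)"]
    by (simp add: reversepath_lseg)
  ultimately have "path_image (seg p q) \<subseteq> lower_cone (sup p q)"
    unfolding seg_def by (rule subset_path_image_join)
  also have "\<dots> \<subseteq> lower_cone m" using assms by (intro cone_mono) simp
  finally show ?thesis .
qed

lemma path_image_seg_X: "bounded_in {p, q} \<Longrightarrow> path_image (seg p q) \<subseteq> X"
  using path_image_seg[of p q] by (auto simp: bounded_in_def lower_cone_def)

fun realise :: "('a set \<times> 'a set) list \<Rightarrow> real \<Rightarrow> 'a set \<times> 'a set \<Rightarrow> real" where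
  "realise [] = (\<lambda>_. undefined)"
| "realise [p] = (\<lambda>_. vtx p)"
| "realise (p # q # u) = seg p q +++ realise (q # u)"

lemma realise_ends:
  "u \<noteq> [] \<Longrightarrow> pathstart (realise u) = vtx (hd u) \<and> pathfinish (realise u) = vtx (last u)"
  by (induction u rule: realise.induct) (auto simp: pathstart_def[of "\<lambda>_. _"] pathfinish_def[of "\<lambda>_. _"])

lemma realise_path: "edge_path u \<Longrightarrow> path (realise u) \<and> path_image (realise u) \<subseteq> X"
proof (induction u rule: realise.induct)
  case 1
  then show ?case by (simp add: edge_path_def)
next
  case (2 p)
  then show ?case using vtx_in_cone[of p p] by (auto simp: path_const_topological lower_cone_def)
next
  case (3 p q u)
  then have v: "path (realise (q # u))" "path_image (realise (q # u)) \<subseteq> X"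
    and pq: "path_image (seg p q) \<subseteq> X"
    using path_image_seg_X by (auto simp: edge_path_Cons)
  then show ?case
    using realise_ends[of "q # u"] path_seg subset_path_image_join[OF pq v(2)] by simp
qed

lemma realise_context:
  assumes "homotopic_paths X (realise (a # ys)) (realise (a # zs))"
  shows "edge_path (xs @ a # ys) \<Longrightarrow> homotopic_paths X (realise (xs @ a # ys)) (realise (xs @ a # zs))"
proof (induction xs)
  case Nil
  then show ?case using assms by simp
next
  case (Cons x xs)
  obtain b us vs where *: "xs @ a # ys = b # us" "xs @ a # zs = b # vs"
    by (cases xs) auto
  have "homotopic_paths X (seg x b +++ realise (b # us)) (seg x b +++ realise (b # vs))"
  proof (rule homotopic_paths_join)
    show "homotopic_paths X (seg x b) (seg x b)"
      using Cons.prems * path_seg path_image_seg_X by (simp add: edge_path_Cons)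
    show "homotopic_paths X (realise (b # us)) (realise (b # vs))"
      using Cons * by (simp add: edge_path_Cons)
  qed (use realise_ends[of "b # us"] in simp)
  then show ?case using * by simp
qed

lemma edge_path_suffix: "edge_path (xs @ ys) \<Longrightarrow> ys \<noteq> [] \<Longrightarrow> edge_path ys"
  by (cases "xs = []") (auto simp: edge_path_append)

text \<open>A stutter is a segment inside one cone, and the three segments of a triangle lie in the
  cone of its upper bound, so \<open>homotopic_paths_cone\<close> applies;
  \<open>realise_context\<close> adds the prefix.\<close>

lemma homotopic_realise:
  assumes "u \<asymp> v" "edge_path u"
  shows "homotopic_paths X (realise u) (realise v)"
  using assms
proof (induction rule: eqv.induct)
  case (eqv_refl u)
  then show ?case using realise_path by simp
next
  case (eqv_sym u v)
  then show ?case using eqv_invariants[OF eqv_sym.hyps] homotopic_paths_sym by blast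
next
  case (eqv_trans u v w)
  then show ?case using eqv_invariants[OF eqv_trans.hyps(1)] homotopic_paths_trans by blast
next
  case (eqv_stutter xs a ys)
  have e: "edge_path (a # a # ys)" using edge_path_suffix[OF eqv_stutter] by simp
  then have e': "edge_path (a # ys)" and a: "a \<in> hom_K2 H" by (auto simp: edge_path_Cons)
  have "homotopic_paths X (seg a a) (\<lambda>_. vtx a)"
    using a path_image_seg[OF a a _ _ a] vtx_in_cone[OF a]
    by (intro homotopic_paths_cone[OF a]) (auto simp: path_seg path_const_topological pathstart_def[of "\<lambda>_. _"] pathfinish_def[of "\<lambda>_. _"])
  then have "homotopic_paths X (seg a a +++ realise (a # ys)) ((\<lambda>_. vtx a) +++ realise (a # ys))"
    using realise_path[OF e'] realise_ends[of "a # ys"] by (intro homotopic_paths_join) auto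
  also have "homotopic_paths X ((\<lambda>_. vtx a) +++ realise (a # ys)) (realise (a # ys))"
    using realise_path[OF e'] realise_ends[of "a # ys"] by (intro homotopic_paths_lid_const) auto
  finally have "homotopic_paths X (realise (a # a # ys)) (realise (a # ys))" by simp
  then show ?case using eqv_stutter by (rule realise_context)
next
  case (eqv_triangle a b c xs ys)
  obtain q where q: "q \<in> hom_K2 H" "a \<le> q" "b \<le> q" "c \<le> q"
    and abc: "a \<in> hom_K2 H" "b \<in> hom_K2 H" "c \<in> hom_K2 H"
    using eqv_triangle.hyps by (auto simp: bounded_in_def)
  have e: "edge_path (c # ys)"
    using edge_path_suffix[of "xs @ [a, b]" "c # ys"] eqv_triangle.prems by simp
  note im = path_image_seg[OF abc(1,2) q(2,3,1)] path_image_seg[OF abc(2,3) q(3,4,1)]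
    path_image_seg[OF abc(1,3) q(2,4,1)]
  have X: "lower_cone q \<subseteq> X" by (auto simp: lower_cone_def)
  have "homotopic_paths X (seg a b +++ (seg b c +++ realise (c # ys))) ((seg a b +++ seg b c) +++ realise (c # ys))"
    using im X realise_path[OF e] realise_ends[of "c # ys"] by (intro homotopic_paths_assoc) (auto simp: path_seg)
  also have "homotopic_paths X \<dots> (seg a c +++ realise (c # ys))"
  proof (rule homotopic_paths_join)
    show "homotopic_paths X (seg a b +++ seg b c) (seg a c)"
      using im by (intro homotopic_paths_cone[OF q(1)] subset_path_image_join) (auto simp: path_seg)
  qed (use realise_path[OF e] realise_ends[of "c # ys"] in auto)
  finally have "homotopic_paths X (realise (a # b # c # ys)) (realise (a # c # ys))" by simp
  then show ?case using eqv_triangle.prems by (rule realise_context)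
qed

text \<open>\<open>realise\<close> nests its joins to the right and ends in a constant path, so a
  segment at the far end has to be reassociated and exchanged with the constant; hence a homotopy
  instead of an equality.\<close>

lemma realise_snoc:
  assumes "edge_path (u @ [p])" "u \<noteq> []"
  shows "homotopic_paths X (realise u +++ seg (last u) p) (realise (u @ [p]))"
  using assms
proof (induction u rule: realise.induct)
  case (2 q)
  then have qp: "bounded_in {q, p}" "p \<in> hom_K2 H" by (auto simp: edge_path_Cons)
  have s: "path (seg q p)" "path_image (seg q p) \<subseteq> X" using path_seg path_image_seg_X[OF qp(1)] by auto
  have "homotopic_paths X ((\<lambda>_. vtx q) +++ seg q p) (seg q p)"
    using s by (intro homotopic_paths_lid_const) auto
  also have "homotopic_paths X \<dots> (seg q p +++ (\<lambda>_. vtx p))"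
    using s by (intro homotopic_paths_sym[OF homotopic_paths_rid_const]) auto
  finally show ?case by simp
next
  case (3 x y u)
  let ?v = "y # u"
  have e: "edge_path (?v @ [p])" and xy: "bounded_in {x, y}"
    using 3(2) by (auto simp: edge_path_Cons)
  have ev: "edge_path ?v" "bounded_in {last ?v, p}"
    using e edge_path_append[of ?v "[p]"] by auto
  have s: "path_image (seg x y) \<subseteq> X" "path_image (seg (last ?v) p) \<subseteq> X"
    using path_image_seg_X[OF xy] path_image_seg_X[OF ev(2)] by auto
  have "homotopic_paths X ((seg x y +++ realise ?v) +++ seg (last ?v) p) (seg x y +++ (realise ?v +++ seg (last ?v) p))"
    using s realise_path[OF ev(1)] realise_ends[of ?v]
    by (intro homotopic_paths_sym[OF homotopic_paths_assoc]) (auto simp: path_seg)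
  also have "homotopic_paths X \<dots> (seg x y +++ realise (?v @ [p]))"
    using 3(1)[OF e] s realise_ends[of ?v] by (intro homotopic_paths_join) (auto simp: path_seg)
  finally show ?case by simp
qed simp

lemma realise_rev: "edge_path u \<Longrightarrow> homotopic_paths X (realise (rev u)) (reversepath (realise u))"
proof (induction u rule: realise.induct)
  case (2 p)
  then show ?case using realise_path[of "[p]"] by (simp add: reversepath_def)
next
  case (3 p q u)
  let ?v = "q # u"
  have ev: "edge_path ?v" and pq: "bounded_in {p, q}" using 3(2) by (auto simp: edge_path_Cons)
  have er: "edge_path (rev ?v @ [p])" using 3(2) edge_path_rev[of "p # q # u"] by simp
  have "homotopic_paths X (realise (rev ?v @ [p])) (realise (rev ?v) +++ seg q p)"
    using homotopic_paths_sym[OF realise_snoc[OF er]] by (simp add: last_rev)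
  also have "homotopic_paths X \<dots> (reversepath (realise ?v) +++ reversepath (seg p q))"
    unfolding reversepath_seg
    using 3(1)[OF ev] realise_ends[of "rev ?v"] path_image_seg_X[of q p] pq
    by (intro homotopic_paths_join) (auto simp: path_seg insert_commute last_rev simp del: rev.simps)
  also have "reversepath (realise ?v) +++ reversepath (seg p q) = reversepath (realise (p # ?v))"
    using realise_ends[of ?v] by (simp add: reversepath_joinpaths)
  finally show ?case by simp
qed (simp add: edge_path_def)

section \<open>Compatibility with the involution\<close>

lemma vtx_swap: "vtx p (prod.swap r) = vtx (prod.swap p) r"
  by (cases p; cases r) (auto simp: vtx_def)

text \<open>The swap preserves suprema and straight segments, so the realizations agree pointwise
  and not merely up to homotopy.\<close>

lemma involution_realise:
  "u \<noteq> [] \<Longrightarrow> hom_K2_involution \<circ> realise u = realise (map prod.swap u)"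
proof (induction u rule: realise.induct)
  case (2 p)
  then show ?case by (auto simp: hom_K2_involution_def vtx_swap fun_eq_iff)
next
  case (3 p q u)
  have l: "hom_K2_involution \<circ> lseg p q = lseg (prod.swap p) (prod.swap q)" for p q
    by (auto simp: hom_K2_involution_def lseg_def mix_def vtx_swap fun_eq_iff)
  have "hom_K2_involution \<circ> seg p q = seg (prod.swap p) (prod.swap q)"
    by (cases p; cases q) (simp add: seg_def path_compose_join l sup_prod_def)
  moreover have "hom_K2_involution \<circ> realise (q # u) = realise (map prod.swap (q # u))"
    by (rule 3) simp
  ultimately show ?case by (simp only: realise.simps list.map path_compose_join)
qed simp

section \<open>From homotopies to equivariant maps\<close>

lemma involution_involution [simp]: "hom_K2_involution (hom_K2_involution t) = t"
  by (simp add: hom_K2_involution_def comp_def)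

lemma involution_X: "t \<in> X \<Longrightarrow> hom_K2_involution t \<in> X"
  and continuous_on_involution: "continuous_on X hom_K2_involution"
  using Z2_space_hom_K2[OF pair_graph_H]
  by (auto simp: Z2_space_def hom_K2_space_eq image_subset_iff)

text \<open>The homotopy \<open>h\<close> on the square gives the upper hemisphere, and equivariance
  dictates the values on the lower one. The two definitions agree on the equator because the
  boundary values of \<open>h\<close> are antipodal under the point reflection of the
  square.\<close>

lemma equivariant_map_of_homotopy:
  assumes hom: "homotopic_paths X \<gamma> (reversepath (hom_K2_involution \<circ> \<gamma>))"
  shows "\<exists>g. continuous_map (nsphere 2) (hom_K2_space H) g \<and>
    (\<forall>x\<in>topspace (nsphere 2). g (\<lambda>i. - x i) = hom_K2_involution (g x))"
proof -
  let ?\<nu> = hom_K2_involution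
  let ?Q = "{0..1::real} \<times> {0..1::real}"
  obtain h where h: "continuous_on ?Q h" "h \<in> ?Q \<rightarrow> X"
    and h': "\<forall>x\<in>{0..1}. h (0, x) = \<gamma> x"
      "\<forall>x\<in>{0..1}. h (1, x) = reversepath (?\<nu> \<circ> \<gamma>) x"
      "\<forall>t\<in>{0..1}. pathstart (h \<circ> Pair t) = pathstart \<gamma> \<and> pathfinish (h \<circ> Pair t) = pathfinish \<gamma>"
    using hom unfolding homotopic_paths by (elim exE conjE) (rule that)
  have h0: "h (0, x) = \<gamma> x" and h1: "h (1, x) = ?\<nu> (\<gamma> (1 - x))"
    and ends: "h (x, 0) = \<gamma> 0 \<and> h (x, 1) = \<gamma> 1" if "x \<in> {0..1}" for x
    using h' that by (simp_all add: pathstart_def pathfinish_def reversepath_def)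
  have \<gamma>0: "\<gamma> 0 = ?\<nu> (\<gamma> 1)"
    using homotopic_paths_imp_pathstart[OF hom] by (simp add: pathstart_def reversepath_def)
  \<comment> \<open>The sides \<open>t = 0\<close> and \<open>t = 1\<close> carry the two homotopic
    paths; on the other two sides \<open>h\<close> is constant, with values
    \<open>\<gamma> 0\<close> and \<open>\<gamma> 1\<close>, which are antipodal.\<close>
  have boundary: "h (1 - t, 1 - x) = ?\<nu> (h (t, x))"
    if "t \<in> {0..1}" "x \<in> {0..1}" and tx: "t \<in> {0, 1} \<or> x \<in> {0, 1}" for t x
  proof -
    consider "t = 0" | "t = 1" | "x = 0" | "x = 1" using tx by blast
    then show ?thesis
    proof cases
      case 1
      then show ?thesis using h0[of x] h1[of "1 - x"] that by simp
    next
      case 2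
      then show ?thesis using h0[of "1 - x"] h1[of x] that by simp
    next
      case 3
      then show ?thesis using ends[of t] ends[of "1 - t"] that \<gamma>0 by simp
    next
      case 4
      then show ?thesis using ends[of t] ends[of "1 - t"] that \<gamma>0 by simp
    qed
  qed
  let ?S = "{x :: nat \<Rightarrow> real. (\<Sum>i\<le>2. (x i)\<^sup>2) = 1 \<and> (\<forall>i>2. x i = 0)}"
  have S: "nsphere 2 = top_of_set ?S"
    by (simp add: nsphere euclidean_product_topology)
  \<comment> \<open>\<open>Z\<close> maps each closed hemisphere onto the unit square and the equator onto its boundary.\<close>
  define D where "D v = max \<bar>v 0\<bar> \<bar>v 1\<bar> + \<bar>v 2\<bar>" for v :: "nat \<Rightarrow> real"
  define Z where "Z v = ((1 + v 0 / D v) / 2, (1 + v 1 / D v) / 2)" for v :: "nat \<Rightarrow> real"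
  have D_pos: "D v > 0" if "v \<in> ?S" for v
  proof (rule ccontr)
    assume "\<not> D v > 0"
    then have "v 0 = 0" "v 1 = 0" "v 2 = 0" by (auto simp: D_def max_def split: if_splits)
    then show False using that by (simp add: numeral_2_eq_2)
  qed
  have neg_S: "(\<lambda>i. - v i) \<in> ?S" if "v \<in> ?S" for v using that by simp
  have frac: "\<bar>v 0 / D v\<bar> \<le> 1" "\<bar>v 1 / D v\<bar> \<le> 1" if "v \<in> ?S" for v
  proof -
    have "\<bar>v 0\<bar> \<le> D v" "\<bar>v 1\<bar> \<le> D v" by (auto simp: D_def)
    then show "\<bar>v 0 / D v\<bar> \<le> 1" "\<bar>v 1 / D v\<bar> \<le> 1" using D_pos[OF that] by simp_all
  qed
  have Z_in: "Z v \<in> ?Q" if "v \<in> ?S" for v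
  proof -
    have "- 1 \<le> v 0 / D v \<and> v 0 / D v \<le> 1 \<and> - 1 \<le> v 1 / D v \<and> v 1 / D v \<le> 1"
      using frac[OF that] by linarith
    then show ?thesis by (auto simp: Z_def)
  qed
  have Z_neg: "Z (\<lambda>i. - v i) = (1 - fst (Z v), 1 - snd (Z v))" for v
    by (auto simp: Z_def D_def field_simps)
  have Z_boundary: "fst (Z v) \<in> {0, 1} \<or> snd (Z v) \<in> {0, 1}" if v: "v \<in> ?S" and v2: "v 2 = 0" for v
  proof -
    have "\<bar>v 0\<bar> = D v \<or> \<bar>v 1\<bar> = D v" using v2 by (auto simp: D_def max_def)
    then have "v 0 / D v \<in> {1, -1} \<or> v 1 / D v \<in> {1, -1}"
      using D_pos[OF v] by (auto simp: abs_if divide_eq_eq split: if_splits)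
    then show ?thesis by (auto simp: Z_def)
  qed
  have cont_coord: "continuous_on T (\<lambda>v :: nat \<Rightarrow> real. v i)" for T i
    by (rule continuous_on_product_then_coordinatewise[OF continuous_on_id])
  have cont_D: "continuous_on ?S D"
    unfolding D_def by (intro continuous_intros cont_coord)
  have cont_Z: "continuous_on ?S Z"
    unfolding Z_def using D_pos by (intro continuous_intros cont_coord cont_D) force+
  have cont_neg: "continuous_on ?S (\<lambda>v i. - v i)"
    by (intro continuous_on_coordinatewise_then_product continuous_on_minus cont_coord)
  \<comment> \<open>The upper hemisphere is written as \<open>- v 2 \<le> 0\<close> to fit the form
    of \<open>continuous_on_cases_le\<close>.\<close>
  define g where "g v = (if - v 2 \<le> 0 then h (Z v) else ?\<nu> (h (Z (\<lambda>i. - v i))))" for v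
  have hX: "h (Z v) \<in> X" if "v \<in> ?S" for v
    using h(2) Z_in[OF that] by (rule funcset_mem)
  have cont1: "continuous_on ?S (\<lambda>v. h (Z v))"
    by (rule continuous_on_compose2[OF h(1) cont_Z]) (intro image_subsetI Z_in)
  have "continuous_on ?S (\<lambda>v. h (Z (\<lambda>i. - v i)))"
    by (rule continuous_on_compose2[OF cont1 cont_neg]) (intro image_subsetI neg_S)
  then have cont2: "continuous_on ?S (\<lambda>v. ?\<nu> (h (Z (\<lambda>i. - v i))))"
    by (rule continuous_on_compose2[OF continuous_on_involution]) (intro image_subsetI hX neg_S)
  have equator: "h (Z (\<lambda>i. - v i)) = ?\<nu> (h (Z v))" if "v \<in> ?S" "v 2 = 0" for v
    using boundary[of "fst (Z v)" "snd (Z v)"] Z_in[OF that(1)] Z_boundary[OF that]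
    by (simp add: Z_neg mem_Times_iff)
  have "continuous_on ?S g"
    unfolding g_def
  proof (rule continuous_on_cases_le)
    show "continuous_on {v \<in> ?S. - v 2 \<le> 0} (\<lambda>v. h (Z v))"
      by (rule continuous_on_subset[OF cont1]) blast
    show "continuous_on {v \<in> ?S. 0 \<le> - v 2} (\<lambda>v. ?\<nu> (h (Z (\<lambda>i. - v i))))"
      by (rule continuous_on_subset[OF cont2]) blast
    show "h (Z v) = ?\<nu> (h (Z (\<lambda>i. - v i)))" if "v \<in> ?S" "- v 2 = 0" for v
      using equator[OF that(1)] that(2) by simp
  qed (rule continuous_on_minus cont_coord)+
  moreover have "g v \<in> X" if "v \<in> ?S" for v
    using hX[OF that] hX[OF neg_S[OF that]] involution_X by (simp add: g_def)
  ultimately have "continuous_map (nsphere 2) (hom_K2_space H) g"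
    unfolding S hom_K2_space_eq by (auto simp: image_subset_iff)
  moreover have "g (\<lambda>i. - v i) = ?\<nu> (g v)" if "v \<in> ?S" for v
    using equator[OF that] by (cases "v 2" "0 :: real" rule: linorder_cases) (auto simp: g_def)
  ultimately show ?thesis
    unfolding S by auto
qed

theorem odd_cycle_imp_coind_ge_2:
  assumes "odd n" "graph_hom f (cycle_graph n) H" "signature H n f = \<one>\<^bsub>G\<^esub>"
  shows "coind (hom_K2_space H) hom_K2_involution \<ge> 2"
proof -
  obtain q where q: "edge_path (map q [0..<Suc n])"
    "map q [0..<Suc n] \<asymp> rev (map prod.swap (map q [0..<Suc n]))"
    by (rule null_loop_of_signature_one[OF assms])
  define u where "u = map q [0..<Suc n]"
  have u: "edge_path u" "u \<asymp> rev (map prod.swap u)" "u \<noteq> []" using q by (simp_all add: u_def)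
  have "edge_path (map prod.swap u)"
    using eqv_invariants[OF u(2)] u(1) edge_path_rev by blast
  then have "homotopic_paths X (realise u) (reversepath (realise (map prod.swap u)))"
    using homotopic_realise[OF u(2,1)] realise_rev homotopic_paths_trans by blast
  then have "homotopic_paths X (realise u) (reversepath (hom_K2_involution \<circ> realise u))"
    by (simp only: involution_realise[OF u(3)])
  then have "ereal (real 2) \<le> coind (hom_K2_space H) hom_K2_involution"
    unfolding coind_def by (intro SUP_upper) (use equivariant_map_of_homotopy in blast)
  then show ?thesis by simp
qed

end

theorem theorem1:
  fixes H :: "'a pair_pre_digraph"
  assumes "pair_graph H"
  shows "coind (hom_K2_space H) hom_K2_involution \<ge> 2 \<longleftrightarrow>
    (\<exists>n f. odd n \<and> n \<ge> 3 \<and> graph_hom f (cycle_graph n) H \<and>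
       signature H n f = \<one>\<^bsub>arc_group H\<^esub>)"
proof -
  interpret arc_graph H using assms by (rule arc_graph.intro)
  show ?thesis
    using coind_ge_2_imp_odd_cycle odd_cycle_imp_coind_ge_2 by blast
qed

end
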